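(* Let $\mathfrak g$ be a finite-dimensional Lie algebra over a field $\mathbb F$ of characteristic zero. Then $\mathfrak g$ is nilpotent if and only if $\mathfrak g$ admits an invertible Leibniz-derivation, i.e. there exist an integer $k\ge 1$ and an invertible linear map $P:\mathfrak g\to\mathfrak g$ that is a Leibniz-derivation of order $k$.
   Context: For a Lie algebra $\mathfrak g$, an integer $k\ge1$ and $x_1,\dots,x_{k+1}\in\mathfrak g$, write $[x_1,\dots,x_{k+1}]$ for the right-nested bracket $[x_1,[x_2,[\dots,[x_k,x_{k+1}]\dots]]]$ (and $[x]=x$ for a single element). A Leibniz-derivation of order $k$ of $\mathfrak g$ is a linear map $P:\mathfrak g\to\mathfrak g$ such that $P([x_1,\dots,x_{k+1}])=\sum_{i=1}^{k+1}[x_1,\dots,x_{i-1},P(x_i),x_{i+1},\dots,x_{k+1}]$ for all $x_1,\dots,x_{k+1}\in\mathfrak g$. The set of these is denoted $\mathcal{L}\mathrm{Der}_k(\mathfrak g)$, and $\mathcal{L}\mathrm{Der}(\mathfrak g)=\bigcup_{k\ge1}\mathcal{L}\mathrm{Der}_k(\mathfrak g)$; its elements are called Leibniz-derivations. Leibniz-derivations of order $1$ are exactly the ordinary derivations. *)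

theory Defs
  imports Complex_Main
begin

definition lie_algebra :: "('a::field \<Rightarrow> 'v::ab_group_add \<Rightarrow> 'v) \<Rightarrow> ('v \<Rightarrow> 'v \<Rightarrow> 'v) \<Rightarrow> bool" where
  "lie_algebra scale br \<longleftrightarrow>
     vector_space scale \<and>
     (\<forall>x. Vector_Spaces.linear scale scale (br x)) \<and>
     (\<forall>y. Vector_Spaces.linear scale scale (\<lambda>x. br x y)) \<and>
     (\<forall>x. br x x = 0) \<and>
     (\<forall>x y z. br x (br y z) + br y (br z x) + br z (br x y) = 0)"

definition fin_dim :: "('a::field \<Rightarrow> 'v::ab_group_add \<Rightarrow> 'v) \<Rightarrow> bool" where
  "fin_dim scale \<longleftrightarrow> (\<exists>B. finite B \<and> module.span scale B = UNIV)"

fun lcs :: "('a::field \<Rightarrow> 'v::ab_group_add \<Rightarrow> 'v) \<Rightarrow> ('v \<Rightarrow> 'v \<Rightarrow> 'v) \<Rightarrow> nat \<Rightarrow> 'v set" where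
  "lcs scale br 0 = UNIV"
| "lcs scale br (Suc n) = module.span scale {br x y | x y. y \<in> lcs scale br n}"

definition lie_nilpotent :: "('a::field \<Rightarrow> 'v::ab_group_add \<Rightarrow> 'v) \<Rightarrow> ('v \<Rightarrow> 'v \<Rightarrow> 'v) \<Rightarrow> bool" where
  "lie_nilpotent scale br \<longleftrightarrow> (\<exists>n. lcs scale br n = {0})"

fun nested :: "('v \<Rightarrow> 'v \<Rightarrow> 'v) \<Rightarrow> 'v list \<Rightarrow> 'v" where
  "nested br [] = undefined"
| "nested br [x] = x"
| "nested br (x # xs) = br x (nested br xs)"

definition leibniz_derivation ::
  "('a::field \<Rightarrow> 'v::ab_group_add \<Rightarrow> 'v) \<Rightarrow> ('v \<Rightarrow> 'v \<Rightarrow> 'v) \<Rightarrow> nat \<Rightarrow> ('v \<Rightarrow> 'v) \<Rightarrow> bool" where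
  "leibniz_derivation scale br k P \<longleftrightarrow>
     Vector_Spaces.linear scale scale P \<and>
     (\<forall>xs. length xs = k + 1 \<longrightarrow>
        P (nested br xs) = (\<Sum>i<k + 1. nested br (xs[i := P (xs ! i)])))"

end

theory Submission
  imports Defs "HOL-Algebra.Algebraic_Closure_Type" "HOL-Library.Product_Plus" "HOL-Library.Function_Algebras"
begin

text \<open>
  If every \<open>k\<close>-fold bracket vanishes, the identity is a Leibniz-derivation of order \<open>k\<close>.

  Conversely let \<open>P\<close> be an invertible Leibniz-derivation of order \<open>k\<close>. After extending scalars to
  the algebraic closure, the algebra \<open>G\<close> is spanned by generalised eigenvectors \<open>x\<close> of \<open>P\<close>, and
  \<open>(ad x)\<^sup>k\<close> shifts the eigenvalues of \<open>P\<close> by \<open>k\<close> times the nonzero eigenvalue of \<open>x\<close>, so every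
  such \<open>x\<close> is ad-nilpotent. The limit \<open>L\<close> of the lower central series is \<open>P\<close>-invariant. If
  \<open>L = G\<close>, then \<open>[P, ad x]\<close> is inner for every \<open>x\<close>; the failure of \<open>P\<close> to be a derivation is then an
  operator \<open>c\<close> in the centroid (up to the centre), and the Leibniz rule of order \<open>k\<close> says that
  \<open>k c\<close> vanishes on \<open>k\<close>-fold brackets, so \<open>P\<close> is a derivation. The generalised eigenvectors are then
  closed under the bracket and Jacobson's variant of Engel's theorem applies. If \<open>L \<noteq> G\<close>, then
  \<open>L\<close> is nilpotent by induction on the dimension, and one climbs up the lower central series:
  modulo the next term, its elements are commutators that are central, hence nilpotent in
  characteristic zero, and the last step to \<open>G\<close> uses the generalised eigenvectors. In both cases
  \<open>G\<close> acts nilpotently on itself.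
\<close>

section \<open>Operators on finite-dimensional subspaces\<close>

context vector_space
begin

lemma dim_less_of_psubset:
  assumes "subspace A" "subspace B" "A \<subset> B" "B \<subseteq> span T" "finite T"
  shows "dim A < dim B"
proof -
  obtain S where S: "S \<subseteq> A" "independent S" "A \<subseteq> span S"
    using maximal_independent_subset by blast
  obtain S' where S': "S \<subseteq> S'" "S' \<subseteq> B" "independent S'" "B \<subseteq> span S'"
    using maximal_independent_subset_extend[of S B] S assms(3) by blast
  have fin: "finite S'" using independent_span_bound[of T S'] S' assms(4,5) by blast
  have "S \<noteq> S'" using S S' assms(1,3) span_minimal[of S A] by blast
  then have "card S < card S'" using S'(1) fin by (meson psubsetI psubset_card_mono)
  moreover have "card S = dim A" "card S' = dim B"
    using S S' by (auto intro: basis_card_eq_dim)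
  ultimately show ?thesis by simp
qed

text \<open>Dimensions are bounded by \<open>card T\<close>, so one can pick a subspace satisfying
  \<open>Q\<close> of greatest dimension.\<close>

lemma ex_maximal_subspace:
  assumes "Q W0" and sub: "\<And>W. Q W \<Longrightarrow> subspace W \<and> W \<subseteq> V" and V: "V \<subseteq> span T" "finite T"
  obtains W where "Q W" "\<And>W'. Q W' \<Longrightarrow> W \<subseteq> W' \<Longrightarrow> W' = W"
proof -
  have bd: "dim W \<le> card T" if "Q W" for W
    using sub[OF that] V dim_le_card[of W T] by blast
  obtain W where W: "Q W" "\<And>W'. Q W' \<Longrightarrow> dim W' \<le> dim W"
    using ex_has_greatest_nat[of Q W0 dim "Suc (card T)"] assms(1) bd
    by (metis le_imp_less_Suc)
  have "W' = W" if "Q W'" "W \<subseteq> W'" for W'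
  proof (rule ccontr)
    assume "W' \<noteq> W"
    then have "dim W < dim W'"
      using that sub[OF W(1)] sub[OF that(1)] V by (intro dim_less_of_psubset[of _ _ T]) auto
    then show False using W(2)[OF that(1)] by simp
  qed
  with W(1) show ?thesis using that by blast
qed

lemma finite_spanning_subset:
  assumes "S \<subseteq> span T" "finite T"
  obtains S' where "finite S'" "S' \<subseteq> S" "S \<subseteq> span S'"
  using maximal_independent_subset[of S] independent_span_bound[of T] assms
  by (metis subset_trans)

text \<open>This is \<open>p(f) v\<close>, evaluated by Horner's scheme, which suits induction over
  \<open>pCons\<close>.\<close>

definition poly_apply :: "('b \<Rightarrow> 'b) \<Rightarrow> 'a poly \<Rightarrow> 'b \<Rightarrow> 'b" where
  "poly_apply f p v = fold_coeffs (\<lambda>a w. a *s v + f w) p 0"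

end

section \<open>Endomorphisms and polynomials in them\<close>

locale vs_endo = vector_space +
  fixes f :: "'b \<Rightarrow> 'b"
  assumes f_add: "f (x + y) = f x + f y" and f_scale: "f (a *s x) = a *s f x"
begin

lemma f_zero: "f 0 = 0"
  using f_scale[of 0 0] by simp

lemma f_minus: "f (- x) = - f x"
  using f_scale[of "-1" x] by simp

lemma f_diff: "f (x - y) = f x - f y"
  using f_add[of x "- y"] f_minus by simp

lemma f_sum: "f (sum g A) = (\<Sum>a\<in>A. f (g a))"
  by (induction A rule: infinite_finite_induct) (auto simp: f_zero f_add)

lemma poly_apply_0: "poly_apply f 0 v = 0"
  by (simp add: poly_apply_def)

lemma poly_apply_pCons: "poly_apply f (pCons a p) v = a *s v + f (poly_apply f p v)"
  by (cases "p = 0 \<and> a = 0") (auto simp: poly_apply_def f_zero)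

lemma poly_apply_add: "poly_apply f (p + q) v = poly_apply f p v + poly_apply f q v"
  by (induction p q rule: poly_induct2)
    (simp_all add: poly_apply_0 poly_apply_pCons f_add scale_left_distrib algebra_simps)

lemma poly_apply_smult: "poly_apply f (smult c p) v = c *s poly_apply f p v"
  by (induction p) (simp_all add: poly_apply_0 poly_apply_pCons f_scale scale_right_distrib)

lemma poly_apply_linear_mult:
  "poly_apply f ([:- \<nu>, 1:] * p) v = f (poly_apply f p v) - \<nu> *s poly_apply f p v"
proof -
  have "[:- \<nu>, 1:] * p = smult (- \<nu>) p + pCons 0 p" by simp
  then show ?thesis
    by (simp only: poly_apply_add poly_apply_pCons poly_apply_smult) simp
qed

lemma poly_apply_monom: "poly_apply f (monom c n) v = c *s (f ^^ n) v"
  by (induction n) (simp_all add: monom_0 monom_Suc poly_apply_pCons poly_apply_0 f_zero f_scale)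

lemma poly_apply_sum: "poly_apply f (sum p A) v = (\<Sum>i\<in>A. poly_apply f (p i) v)"
  by (induction A rule: infinite_finite_induct) (auto simp: poly_apply_0 poly_apply_add)

lemma poly_apply_in:
  assumes "subspace V" "f ` V \<subseteq> V" "v \<in> V" shows "poly_apply f p v \<in> V"
  by (induction p)
    (use assms in \<open>auto simp: poly_apply_0 poly_apply_pCons subspace_0 intro!: subspace_add subspace_scale\<close>)

lemma ex_annihilating_poly:
  assumes V: "f ` V \<subseteq> V" "V \<subseteq> span T" "finite T" "v \<in> V"
  shows "\<exists>p. p \<noteq> 0 \<and> poly_apply f p v = 0"
\<comment> \<open>Linear dependence is a property of sets, so a repetition among the iterates of
  \<open>v\<close> is treated apart; it gives a polynomial with two terms.\<close>
proof (cases "inj (\<lambda>n. (f ^^ n) v)")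
  case False
  then obtain i j where ij: "i \<noteq> j" "(f ^^ i) v = (f ^^ j) v" by (auto simp: inj_def)
  have "monom 1 i + monom (-1) j \<noteq> (0 :: 'a poly)"
  proof
    assume "monom 1 i + monom (-1) j = (0 :: 'a poly)"
    then have "coeff (monom 1 i + monom (-1) j :: 'a poly) i = 0" by simp
    with ij show False by simp
  qed
  moreover have "poly_apply f (monom 1 i + monom (-1) j) v = 0"
    using ij by (simp add: poly_apply_add poly_apply_monom)
  ultimately show ?thesis by blast
next
  case True
  have in_V: "(f ^^ n) v \<in> V" for n by (induction n) (use V in auto)
  have "dependent (range (\<lambda>n. (f ^^ n) v))"
  proof (rule ccontr)
    assume "independent (range (\<lambda>n. (f ^^ n) v))"
    then have "finite (range (\<lambda>n. (f ^^ n) v))"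
      using independent_span_bound[OF V(3)] in_V V(2) by blast
    with True show False using finite_imageD by blast
  qed
  then obtain S u w where S: "finite S" "S \<subseteq> range (\<lambda>n. (f ^^ n) v)" "(\<Sum>x\<in>S. u x *s x) = 0"
      "w \<in> S" "u w \<noteq> 0"
    unfolding dependent_explicit by blast
  obtain N where N: "S = (\<lambda>n. (f ^^ n) v) ` N" "finite N"
    using S(1,2) by (metis finite_subset_image)
  define p where "p = (\<Sum>i\<in>N. monom (u ((f ^^ i) v)) i)"
  have "poly_apply f p v = (\<Sum>i\<in>N. u ((f ^^ i) v) *s (f ^^ i) v)"
    by (simp add: p_def poly_apply_sum poly_apply_monom)
  also have "\<dots> = (\<Sum>x\<in>S. u x *s x)"
    unfolding N(1) by (subst sum.reindex) (use True in \<open>auto intro: inj_on_subset\<close>)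
  finally have "poly_apply f p v = 0" using S(3) by simp
  moreover obtain i where i: "i \<in> N" "w = (f ^^ i) v" using S(4) N by auto
  have "coeff p i = u w"
    using i N(2) by (simp add: p_def coeff_sum)
  with S(5) have "p \<noteq> 0" by auto
  ultimately show ?thesis by blast
qed

lemma ex_minimal_poly_mod:
  assumes V: "f ` V \<subseteq> V" "V \<subseteq> span T" "finite T" "v \<in> V" and W: "subspace W"
  obtains p where "p \<noteq> 0" "poly_apply f p v \<in> W"
    "\<And>q. q \<noteq> 0 \<Longrightarrow> poly_apply f q v \<in> W \<Longrightarrow> degree p \<le> degree q"
proof -
  have "\<exists>p. p \<noteq> 0 \<and> poly_apply f p v \<in> W"
    using ex_annihilating_poly[OF V] subspace_0[OF W] by metis
  then show ?thesis
    using ex_has_least_nat[of "\<lambda>p. p \<noteq> 0 \<and> poly_apply f p v \<in> W" _ degree] that by metis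
qed

end

locale ac_vs_endo = vs_endo scale f
  for scale :: "'a::{alg_closed_field,field_char_0} \<Rightarrow> 'b::ab_group_add \<Rightarrow> 'b" and f
begin

text \<open>A root \<open>\<nu>\<close> of the minimal polynomial \<open>p\<close> of some
  \<open>v\<close> modulo \<open>W\<close> splits off as \<open>p = (X - \<nu>) q\<close>. By
  minimality \<open>q(f) v\<close> is outside \<open>W\<close>, and it is the wanted eigenvector
  modulo \<open>W\<close>.\<close>

lemma ex_eigenvector_mod:
  assumes "subspace V" "f ` V \<subseteq> V" "V \<subseteq> span T" "finite T" "subspace W" "W \<subset> V"
  obtains e \<nu> where "e \<in> V" "e \<notin> W" "f e - scale \<nu> e \<in> W"
proof -
  obtain v where v: "v \<in> V" "v \<notin> W" using assms by blast
  obtain p where p: "p \<noteq> 0" "poly_apply f p v \<in> W"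
    "\<And>q. q \<noteq> 0 \<Longrightarrow> poly_apply f q v \<in> W \<Longrightarrow> degree p \<le> degree q"
    using ex_minimal_poly_mod[OF assms(2-4) v(1) assms(5)] by blast
  have "degree p > 0"
  proof (rule ccontr)
    assume "\<not> degree p > 0"
    then obtain c where c: "p = [:c:]" by (metis degree_eq_zeroE not_gr_zero)
    then have "scale c v \<in> W" "c \<noteq> 0" using p by (auto simp: poly_apply_pCons poly_apply_0 f_zero)
    then have "scale (inverse c) (scale c v) \<in> W" using subspace_scale[OF assms(5)] by blast
    then show False using v \<open>c \<noteq> 0\<close> by simp
  qed
  then obtain \<nu> where "poly p \<nu> = 0" using alg_closed_imp_poly_has_root by blast
  then obtain q where q: "p = [:- \<nu>, 1:] * q" by (metis dvdE poly_eq_0_iff_dvd)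
  with p have "q \<noteq> 0" by auto
  then have "degree p = Suc (degree q)" unfolding q by (subst degree_mult_eq) auto
  then have "poly_apply f q v \<notin> W" using p(3)[OF \<open>q \<noteq> 0\<close>] by auto
  moreover have "f (poly_apply f q v) - scale \<nu> (poly_apply f q v) \<in> W"
    using p(2) unfolding q poly_apply_linear_mult .
  ultimately show ?thesis using that poly_apply_in[OF assms(1,2) v(1)] by blast
qed

end

section \<open>Nilpotent actions of Lie algebras\<close>

locale lie = vector_space +
  fixes br :: "'b \<Rightarrow> 'b \<Rightarrow> 'b"
  assumes br_add_left: "br (x + y) z = br x z + br y z"
    and br_scale_left: "br (a *s x) z = a *s br x z"
    and br_add_right: "br z (x + y) = br z x + br z y"
    and br_scale_right: "br z (a *s x) = a *s br z x"
    and br_self: "br x x = 0"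
    and br_jacobi: "br x (br y z) + br y (br z x) + br z (br x y) = 0"
begin

sublocale ad: vs_endo scale "br x" for x
  by unfold_locales (rule br_add_right br_scale_right)+

sublocale ad_right: vs_endo scale "\<lambda>x. br x y" for y
  by unfold_locales (rule br_add_left br_scale_left)+

lemmas br_zero_right = ad.f_zero
  and br_minus_right = ad.f_minus
  and br_diff_right = ad.f_diff
  and br_zero_left = ad_right.f_zero
  and br_diff_left = ad_right.f_diff

lemma br_swap: "br x y = - br y x"
proof -
  have "br (x + y) (x + y) = (br x x + br x y) + (br y x + br y y)"
    by (simp only: br_add_left br_add_right add.assoc add.left_commute)
  then have "br x y + br y x = 0" by (simp add: br_self)
  then show ?thesis by (simp add: eq_neg_iff_add_eq_0)
qed

lemma br_br_left: "br (br x y) z = br x (br y z) - br y (br x z)"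
  using br_jacobi[of x y z] br_swap[of z x] br_swap[of z "br x y"] by (simp add: br_minus_right)

lemma foldr_br_add: "foldr br us (x + y) = foldr br us x + foldr br us y"
  by (induction us) (auto simp: br_add_right)

lemma foldr_br_scale: "foldr br us (a *s x) = a *s foldr br us x"
  by (induction us) (auto simp: br_scale_right)

sublocale foldr_br: vs_endo scale "foldr br us" for us
  by unfold_locales (rule foldr_br_add foldr_br_scale)+

lemma span_br_left: 
  assumes "subspace W" "\<And>x. x \<in> I \<Longrightarrow> br x u \<in> W" "x \<in> span I"
  shows "br x u \<in> W"
proof -
  have "subspace {x. br x u \<in> W}"
    using assms(1) by (auto simp: subspace_def br_add_left br_scale_left br_zero_left)
  with assms(2,3) span_minimal[of I "{x. br x u \<in> W}"] show ?thesis by blast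
qed

lemma span_br_right:
  assumes "subspace W" "\<And>x. x \<in> I \<Longrightarrow> br u x \<in> W" "x \<in> span I"
  shows "br u x \<in> W"
proof -
  have "subspace {x. br u x \<in> W}"
    using assms(1) by (auto simp: subspace_def br_add_right br_scale_right br_zero_right)
  with assms(2,3) span_minimal[of I "{x. br u x \<in> W}"] show ?thesis by blast
qed

text \<open>Finite dimension is part of the notion because the ambient type may be
  infinite-dimensional, as the function space used for extending scalars can be.\<close>

definition subalgebra :: "'b set \<Rightarrow> bool" where
  "subalgebra G \<longleftrightarrow> subspace G \<and> (\<forall>x\<in>G. \<forall>y\<in>G. br x y \<in> G) \<and> (\<exists>T. finite T \<and> G \<subseteq> span T)"

section \<open>The lower central series of a subalgebra\<close>

lemma foldr_br_in:
  assumes "\<And>x y. x \<in> A \<Longrightarrow> y \<in> V \<Longrightarrow> br x y \<in> V" "set us \<subseteq> A" "v \<in> V"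
  shows "foldr br us v \<in> V"
  using assms(2,3) by (induction us) (auto intro: assms(1))

text \<open>Given by explicit words with \<open>j\<close> brackets rather than by recursion, because
  the Leibniz rule speaks of words; \<open>lower_central_Suc\<close> recovers the recursion.\<close>

definition lower_central :: "'b set \<Rightarrow> nat \<Rightarrow> 'b set" where
  "lower_central G j = span {foldr br us v |us v. length us = j \<and> set us \<subseteq> G \<and> v \<in> G}"

lemma subspace_lower_central: "subspace (lower_central G j)"
  by (simp add: lower_central_def)

lemma lower_central_0: "subspace G \<Longrightarrow> lower_central G 0 = G"
  by (simp add: lower_central_def)

lemma foldr_br_in_lower_central:
  assumes "set us \<subseteq> G" "y \<in> lower_central G j"
  shows "foldr br us y \<in> lower_central G (length us + j)"
proof -
  have "subspace {y. foldr br us y \<in> lower_central G (length us + j)}"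
    using subspace_lower_central[of G "length us + j"]
    by (auto simp: subspace_def foldr_br_add foldr_br_scale foldr_br.f_zero)
  moreover have "{foldr br us v |us v. length us = j \<and> set us \<subseteq> G \<and> v \<in> G}
      \<subseteq> {y. foldr br us y \<in> lower_central G (length us + j)}"
  proof safe
    fix vs v assume *: "j = length vs" "set vs \<subseteq> G" "v \<in> G"
    have "foldr br us (foldr br vs v) = foldr br (us @ vs) v" by simp
    then show "foldr br us (foldr br vs v) \<in> lower_central G (length us + length vs)"
      unfolding lower_central_def using * assms(1)
      by (intro span_base CollectI exI[of _ "us @ vs"] exI[of _ v]) auto
  qed
  ultimately show ?thesis
    using assms(2) span_minimal unfolding lower_central_def[of G j] by blast
qed

lemma br_in_lower_central: "x \<in> G \<Longrightarrow> y \<in> lower_central G j \<Longrightarrow> br x y \<in> lower_central G (Suc j)"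
  using foldr_br_in_lower_central[of "[x]"] by simp

lemma lower_central_Suc:
  "lower_central G (Suc j) = span {br x y |x y. x \<in> G \<and> y \<in> lower_central G j}"
proof
  show "lower_central G (Suc j) \<subseteq> span {br x y |x y. x \<in> G \<and> y \<in> lower_central G j}"
    unfolding lower_central_def[of G "Suc j"]
  proof (rule span_mono, safe)
    fix us :: "'b list" and v assume *: "length us = Suc j" "set us \<subseteq> G" "v \<in> G"
    then obtain x vs where us: "us = x # vs" by (cases us) auto
    have "foldr br vs v \<in> lower_central G j"
      unfolding lower_central_def using * us by (intro span_base) auto
    then show "\<exists>x y. foldr br us v = br x y \<and> x \<in> G \<and> y \<in> lower_central G j"
      using * us by auto
  qed
  show "span {br x y |x y. x \<in> G \<and> y \<in> lower_central G j} \<subseteq> lower_central G (Suc j)"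
    by (rule span_minimal) (auto intro: br_in_lower_central subspace_lower_central)
qed

lemma lower_central_subset: "subalgebra G \<Longrightarrow> lower_central G j \<subseteq> G"
  unfolding lower_central_def subalgebra_def
  by (rule span_minimal) (auto intro!: foldr_br_in[of G G])

lemma lower_central_decreasing: "subalgebra G \<Longrightarrow> lower_central G (Suc j) \<subseteq> lower_central G j"
proof (induction j)
  case 0
  then show ?case
    using lower_central_subset lower_central_0 by (auto simp: subalgebra_def)
next
  case (Suc j)
  then show ?case
    unfolding lower_central_Suc[of G "Suc j"] lower_central_Suc[of G j]
    by (intro span_mono) blast
qed

lemma lower_central_antimono:
  assumes "subalgebra G" "i \<le> j" shows "lower_central G j \<subseteq> lower_central G i"
  using lift_Suc_antimono_le[of "lower_central G", OF lower_central_decreasing[OF assms(1)] assms(2)] .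

text \<open>In a decreasing chain of finite-dimensional spaces, a term of least dimension equals all
  later ones.\<close>

lemma lower_central_stable:
  assumes G: "subalgebra G"
  obtains N where "\<And>n. n \<ge> N \<Longrightarrow> lower_central G n = lower_central G N"
proof -
  obtain N where N: "\<And>n. dim (lower_central G N) \<le> dim (lower_central G n)"
    using ex_has_least_nat[of "\<lambda>_. True" _ "\<lambda>n. dim (lower_central G n)"] by blast
  obtain T where T: "finite T" "G \<subseteq> span T" using G by (auto simp: subalgebra_def)
  have "lower_central G n = lower_central G N" if "n \<ge> N" for n
  proof (rule ccontr)
    assume "lower_central G n \<noteq> lower_central G N"
    then have "lower_central G n \<subset> lower_central G N"
      using lower_central_antimono[OF G that] by blast
    then have "dim (lower_central G n) < dim (lower_central G N)"
      using dim_less_of_psubset[OF subspace_lower_central subspace_lower_central] T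
        lower_central_subset[OF G] by blast
    with N[of n] show False by simp
  qed
  then show ?thesis using that by blast
qed

lemma lower_central_subalgebra:
  assumes "subalgebra G" shows "subalgebra (lower_central G j)"
  unfolding subalgebra_def
  using lower_central_subset[OF assms, of j] lower_central_decreasing[OF assms, of j]
    br_in_lower_central[of _ G _ j] subspace_lower_central assms
  by (meson subalgebra_def subset_iff)

text \<open>A form of ``\<open>I\<close> acts nilpotently on \<open>G\<close>'' that survives the passage to subquotients of \<open>G\<close>
  and so makes it unnecessary to construct them.\<close>

definition acts_nilpotently :: "'b set \<Rightarrow> 'b set \<Rightarrow> bool" where
  "acts_nilpotently G I \<longleftrightarrow> (\<forall>U W. subspace U \<longrightarrow> subspace W \<longrightarrow> W \<subset> U \<longrightarrow> U \<subseteq> G \<longrightarrow>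
     (\<forall>x\<in>I. \<forall>u\<in>U. br x u \<in> U) \<longrightarrow> (\<forall>x\<in>I. \<forall>w\<in>W. br x w \<in> W) \<longrightarrow>
     (\<exists>u\<in>U - W. \<forall>x\<in>I. br x u \<in> W))"

definition ad_nilpotent :: "'b set \<Rightarrow> 'b \<Rightarrow> bool" where
  "ad_nilpotent G z \<longleftrightarrow> (\<forall>v\<in>G. \<exists>n. (br z ^^ n) v = 0)"

section \<open>Enlarging nilpotent actions in the style of Engel's theorem\<close>

lemma acts_nilpotentlyD:
  assumes "acts_nilpotently G I" "subspace U" "subspace W" "W \<subset> U" "U \<subseteq> G"
    "\<And>x u. x \<in> I \<Longrightarrow> u \<in> U \<Longrightarrow> br x u \<in> U" "\<And>x w. x \<in> I \<Longrightarrow> w \<in> W \<Longrightarrow> br x w \<in> W"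
  obtains u where "u \<in> U" "u \<notin> W" "\<And>x. x \<in> I \<Longrightarrow> br x u \<in> W"
  using assms unfolding acts_nilpotently_def by (metis DiffD1 DiffD2)

lemma acts_nilpotentlyI:
  assumes "\<And>U W. \<lbrakk>subspace U; subspace W; W \<subset> U; U \<subseteq> G;
    \<And>x u. x \<in> I \<Longrightarrow> u \<in> U \<Longrightarrow> br x u \<in> U; \<And>x w. x \<in> I \<Longrightarrow> w \<in> W \<Longrightarrow> br x w \<in> W\<rbrakk>
    \<Longrightarrow> \<exists>u\<in>U - W. \<forall>x\<in>I. br x u \<in> W"
  shows "acts_nilpotently G I"
  unfolding acts_nilpotently_def using assms by simp

lemma acts_nilpotently_span: "acts_nilpotently G (span I) \<longleftrightarrow> acts_nilpotently G I"
proof -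
  have *: "(\<forall>x\<in>span I. br x u \<in> W) \<longleftrightarrow> (\<forall>x\<in>I. br x u \<in> W)" if "subspace W" for u W
    using span_br_left[OF that, of I u] span_base[of _ I] by blast
  have **: "(\<forall>x\<in>span I. \<forall>u\<in>U. br x u \<in> W) \<longleftrightarrow> (\<forall>x\<in>I. \<forall>u\<in>U. br x u \<in> W)" if "subspace W" for U W
    using *[OF that] by blast
  show ?thesis
    unfolding acts_nilpotently_def by (simp only: * ** cong: imp_cong)
qed

text \<open>The induction step of Engel's theorem. Since \<open>z\<close> normalises
  \<open>span I\<close>, the vectors of \<open>U\<close> that \<open>I\<close> maps into
  \<open>W\<close> are stable under \<open>br z\<close>. When the nilpotent \<open>br z\<close> is
  iterated on one outside \<open>W\<close>, the last iterate outside \<open>W\<close> is sent into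
  \<open>W\<close> by \<open>z\<close> as well.\<close>

lemma acts_nilpotently_insert:
  assumes I: "acts_nilpotently G I" and z: "\<And>x. x \<in> I \<Longrightarrow> br z x \<in> span I" "ad_nilpotent G z"
  shows "acts_nilpotently G (insert z I)"
proof (rule acts_nilpotentlyI)
  fix U W assume U: "subspace U" "U \<subseteq> G" and W: "subspace W" and "W \<subset> U"
    and inv: "\<And>x u. x \<in> insert z I \<Longrightarrow> u \<in> U \<Longrightarrow> br x u \<in> U"
      "\<And>x w. x \<in> insert z I \<Longrightarrow> w \<in> W \<Longrightarrow> br x w \<in> W"
  obtain u0 where u0: "u0 \<in> U" "u0 \<notin> W" "\<And>x. x \<in> I \<Longrightarrow> br x u0 \<in> W"
    using acts_nilpotentlyD[OF I U(1) W \<open>W \<subset> U\<close> U(2)] inv by blast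
  have step: "br z u \<in> U \<and> (\<forall>x\<in>I. br x (br z u) \<in> W)"
    if u: "u \<in> U" "\<forall>x\<in>I. br x u \<in> W" for u
  proof (intro conjI ballI)
    fix x assume x: "x \<in> I"
    have "br (br z x) u \<in> W"
      using span_br_left[OF W _ z(1)[OF x], of u] u(2) by blast
    moreover have "br z (br x u) \<in> W" using u(2) x inv(2) by blast
    moreover have "br x (br z u) = br z (br x u) - br (br z x) u" by (simp add: br_br_left)
    ultimately show "br x (br z u) \<in> W" using subspace_diff[OF W] by simp
  qed (use inv u in blast)
  have pow: "(br z ^^ n) u0 \<in> U \<and> (\<forall>x\<in>I. br x ((br z ^^ n) u0) \<in> W)" for n
    by (induction n) (use u0 step in auto)
  obtain n where "(br z ^^ n) u0 = 0"
    using z(2) u0(1) U(2) unfolding ad_nilpotent_def by blast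
  then have "(br z ^^ n) u0 \<in> W" using subspace_0[OF W] by simp
  then obtain m where m: "(br z ^^ m) u0 \<notin> W" "(br z ^^ Suc m) u0 \<in> W"
    using u0(2) by (induction n) auto
  then show "\<exists>u\<in>U - W. \<forall>x\<in>insert z I. br x u \<in> W"
    using pow[of m] by (intro bexI[of _ "(br z ^^ m) u0"]) auto
qed

text \<open>All brackets of \<open>S\<close> with \<open>I \<union> S\<close> fall into
  \<open>span I\<close>, so each element of \<open>S\<close> normalises whatever was adjoined before
  it, and the elements can be added one at a time.\<close>

lemma acts_nilpotently_Un_finite:
  assumes "finite S" "acts_nilpotently G I" "\<And>z. z \<in> S \<Longrightarrow> ad_nilpotent G z"
    "\<And>z x. z \<in> S \<Longrightarrow> x \<in> I \<union> S \<Longrightarrow> br z x \<in> span I"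
  shows "acts_nilpotently G (I \<union> S)"
  using assms
proof (induction S rule: finite_induct)
  case (insert z S)
  have "acts_nilpotently G (insert z (I \<union> S))"
  proof (rule acts_nilpotently_insert)
    show "acts_nilpotently G (I \<union> S)" by (rule insert.IH) (use insert.prems in auto)
    show "br z x \<in> span (I \<union> S)" if "x \<in> I \<union> S" for x
      using insert.prems(3)[of z x] that span_mono[of I "I \<union> S"] by blast
    show "ad_nilpotent G z" using insert.prems by blast
  qed
  then show ?case by simp
qed simp

text \<open>Nilpotency of an action depends only on the span, so \<open>S\<close> may be replaced by
  a finite spanning subset.\<close>

lemma acts_nilpotently_extend:
  assumes "S \<subseteq> span T" "finite T" "acts_nilpotently G I" "\<And>z. z \<in> S \<Longrightarrow> ad_nilpotent G z"
    "\<And>z x. z \<in> S \<Longrightarrow> x \<in> I \<union> S \<Longrightarrow> br z x \<in> span I"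
  shows "acts_nilpotently G (span (I \<union> S))"
proof -
  obtain S' where S': "finite S'" "S' \<subseteq> S" "S \<subseteq> span S'"
    using finite_spanning_subset[OF assms(1,2)] by blast
  have "acts_nilpotently G (I \<union> S')"
    by (rule acts_nilpotently_Un_finite) (use S' assms in blast)+
  moreover have "span (I \<union> S') = span (I \<union> S)"
    unfolding span_eq using S' span_mono[of S' "I \<union> S'"] span_superset[of "I \<union> S'"]
      span_superset[of "I \<union> S"] by blast
  ultimately show ?thesis using acts_nilpotently_span by metis
qed

text \<open>Starting from \<open>v\<close> in \<open>U\<close> outside \<open>W\<close>, apply
  elements of \<open>L\<close> as long as the result stays outside \<open>W\<close>. This stops, and
  every element of \<open>L\<close> sends the last vector reached into \<open>W\<close>.\<close>

lemma acts_nilpotently_ideal: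
  assumes "subspace L" "\<And>x v. x \<in> L \<Longrightarrow> v \<in> G \<Longrightarrow> br x v \<in> L" "lower_central L n = {0}"
  shows "acts_nilpotently G L"
proof (rule acts_nilpotentlyI)
  fix U W assume U: "subspace U" "U \<subseteq> G" and W: "subspace W" and "W \<subset> U"
    and inv: "\<And>x u. x \<in> L \<Longrightarrow> u \<in> U \<Longrightarrow> br x u \<in> U"
  obtain v where v: "v \<in> U" "v \<notin> W" using \<open>W \<subset> U\<close> by blast
  define Q where "Q m \<longleftrightarrow> (\<exists>us. length us = m \<and> set us \<subseteq> L \<and> foldr br us v \<notin> W)" for m
  \<comment> \<open>One factor more than \<open>n\<close>: the innermost bracket only brings
    \<open>v\<close> into \<open>L\<close>, and the remaining \<open>n\<close> then land in
    \<open>lower_central L n\<close>.\<close>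
  have "\<not> Q (Suc n)"
  proof
    assume "Q (Suc n)"
    then obtain us where us: "length us = Suc n" "set us \<subseteq> L" "foldr br us v \<notin> W"
      by (auto simp: Q_def)
    then obtain vs x where vs: "us = vs @ [x]" by (metis length_0_conv nat.simps(3) rev_exhaust)
    have "br x v \<in> L" using us vs v U(2) by (intro assms(2)) auto
    then have "foldr br us v \<in> lower_central L n"
      unfolding lower_central_def using us vs by (intro span_base) auto
    with us(3) subspace_0[OF W] show False by (simp add: assms(3))
  qed
  moreover have "Q 0" using v by (simp add: Q_def)
  ultimately obtain m where m: "Q m" "\<not> Q (Suc m)" by (metis nat_induct)
  then obtain us where us: "length us = m" "set us \<subseteq> L" "foldr br us v \<notin> W"
    by (auto simp: Q_def)
  have "br x (foldr br us v) \<in> W" if "x \<in> L" for x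
    using m(2) us that unfolding Q_def by (metis foldr_Cons comp_apply insert_subset length_Cons list.simps(15))
  moreover have "foldr br us v \<in> U" using foldr_br_in[OF inv us(2) v(1)] .
  ultimately show "\<exists>u\<in>U - W. \<forall>x\<in>L. br x u \<in> W" using us(3) by blast
qed

text \<open>If the stable term \<open>L = [G, L]\<close> were nonzero, take a maximal proper
  \<open>G\<close>-stable subspace \<open>W\<close> of it. The vectors of \<open>L\<close> that
  \<open>G\<close> maps into \<open>W\<close> form a strictly larger stable subspace, hence all of
  \<open>L\<close>. So \<open>[G, L]\<close> lies in \<open>W\<close>, which is absurd.\<close>

lemma nilpotent_of_acts_nilpotently:
  assumes G: "subalgebra G" and "acts_nilpotently G G"
  shows "\<exists>n. lower_central G n = {0}"
proof -
  obtain N where N: "\<And>n. n \<ge> N \<Longrightarrow> lower_central G n = lower_central G N"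
    using lower_central_stable[OF G] by blast
  obtain T where T: "finite T" "G \<subseteq> span T" using G by (auto simp: subalgebra_def)
  define L where "L = lower_central G N"
  have L: "subspace L" "L \<subseteq> G" "\<And>x l. x \<in> G \<Longrightarrow> l \<in> L \<Longrightarrow> br x l \<in> L"
    using N[of "Suc N"] br_in_lower_central[of _ G _ N]
    by (auto simp: L_def subspace_lower_central intro: subsetD[OF lower_central_subset[OF G]])
  have span_L: "L = span {br x y |x y. x \<in> G \<and> y \<in> L}"
    using N[of "Suc N"] by (simp add: L_def lower_central_Suc)
  have "L = {0}"
  proof (rule ccontr)
    assume "L \<noteq> {0}"
    then have "{0} \<subset> L" using subspace_0[OF L(1)] by blast
    define Q where "Q W \<longleftrightarrow> subspace W \<and> W \<subset> L \<and> (\<forall>x\<in>G. \<forall>w\<in>W. br x w \<in> W)" for W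
    have "Q {0}" using \<open>{0} \<subset> L\<close> by (simp add: Q_def br_zero_right)
    obtain W where W: "Q W" "\<And>W'. Q W' \<Longrightarrow> W \<subseteq> W' \<Longrightarrow> W' = W"
    proof (rule ex_maximal_subspace[of Q "{0}" L T])
      show "L \<subseteq> span T" using T L(2) by blast
      show "subspace W \<and> W \<subseteq> L" if "Q W" for W using that by (auto simp: Q_def)
    qed (use T \<open>Q {0}\<close> in blast)+
    obtain u where u: "u \<in> L" "u \<notin> W" "\<And>x. x \<in> G \<Longrightarrow> br x u \<in> W"
    proof (rule acts_nilpotentlyD[OF assms(2) L(1), of W])
      show "subspace W" "W \<subset> L" "\<And>x w. x \<in> G \<Longrightarrow> w \<in> W \<Longrightarrow> br x w \<in> W"
        using W(1) by (auto simp: Q_def)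
    qed (use L in auto)
    define U where "U = {u \<in> L. \<forall>x\<in>G. br x u \<in> W}"
    have "subspace U"
      using W(1) L(1) unfolding U_def Q_def
      by (auto simp: subspace_def br_add_right br_scale_right br_zero_right)
    moreover have "W \<subseteq> U" "U \<subseteq> L" using W(1) unfolding U_def Q_def by auto
    moreover have "U \<noteq> W" using u unfolding U_def by blast
    ultimately have "\<not> Q U" using W(2)[of U] by blast
    then have "U = L"
      using \<open>subspace U\<close> \<open>W \<subseteq> U\<close> \<open>U \<subseteq> L\<close> unfolding Q_def U_def by blast
    then have "span {br x y |x y. x \<in> G \<and> y \<in> L} \<subseteq> W"
      by (intro span_minimal) (use W(1) in \<open>auto simp: U_def Q_def\<close>)
    then show False using span_L W(1) by (auto simp: Q_def)
  qed
  then show ?thesis by (auto simp: L_def)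
qed

end

section \<open>Commutators in characteristic zero\<close>

locale ac_lie = lie scale br
  for scale :: "'a::{alg_closed_field,field_char_0} \<Rightarrow> 'b::ab_group_add \<Rightarrow> 'b" and br
begin

sublocale ac_ad: ac_vs_endo scale "br x" for x ..

text \<open>Two operators whose commutator is a nonzero scalar cannot act on a nonzero
  finite-dimensional space of characteristic zero: if \<open>e\<close> is an eigenvector of the second
  operator and \<open>p\<close> the minimal polynomial of \<open>e\<close> under the first one, then the
  derivative of \<open>p\<close> also annihilates \<open>e\<close>.\<close>

lemma commutator_not_scalar:
  assumes U: "subspace U" "U \<subseteq> span T" "finite T" and W: "subspace W" "W \<subset> U"
    and x: "\<And>u. u \<in> U \<Longrightarrow> br x u \<in> U" "\<And>w. w \<in> W \<Longrightarrow> br x w \<in> W"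
    and y: "\<And>u. u \<in> U \<Longrightarrow> br y u \<in> U" "\<And>w. w \<in> W \<Longrightarrow> br y w \<in> W"
    and z: "\<And>u. u \<in> U \<Longrightarrow> br (br x y) u - scale \<mu> u \<in> W"
  shows "\<mu> = 0"
proof (rule ccontr)
  assume "\<mu> \<noteq> 0"
  obtain e \<nu> where e: "e \<in> U" "e \<notin> W" "br y e - scale \<nu> e \<in> W"
    using ac_ad.ex_eigenvector_mod[of U y T W] U W y(1) by blast
  obtain p where p: "p \<noteq> 0" "poly_apply (br x) p e \<in> W"
    "\<And>q. q \<noteq> 0 \<Longrightarrow> poly_apply (br x) q e \<in> W \<Longrightarrow> degree p \<le> degree q"
    using ad.ex_minimal_poly_mod[of x U T e W] U e x W(1) by blast
  have in_U: "poly_apply (br x) q e \<in> U" for q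
    using ad.poly_apply_in[OF U(1) _ e(1), of x] x(1) by blast
  \<comment> \<open>Modulo \<open>W\<close> this reads
    \<open>(y - \<nu>) q(x) e = - \<mu> q'(x) e\<close>: moving \<open>y\<close> past each factor
    \<open>x\<close> costs \<open>- \<mu>\<close>, as in the Weyl algebra.\<close>
  have key: "br y (poly_apply (br x) q e) - scale \<nu> (poly_apply (br x) q e)
      + scale \<mu> (poly_apply (br x) (pderiv q) e) \<in> W" for q
  proof (induction q)
    case 0
    then show ?case using subspace_0[OF W(1)] by (simp add: ad.poly_apply_0 br_zero_right)
  next
    case (pCons a q)
    define u where "u = poly_apply (br x) q e"
    define u' where "u' = poly_apply (br x) (pderiv q) e"
    have eq: "br y (poly_apply (br x) (pCons a q) e) - scale \<nu> (poly_apply (br x) (pCons a q) e)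
      + scale \<mu> (poly_apply (br x) (pderiv (pCons a q)) e)
      = scale a (br y e - scale \<nu> e) + br x (br y u - scale \<nu> u + scale \<mu> u')
        - (br (br x y) u - scale \<mu> u)"
      by (simp add: pderiv_pCons ad.poly_apply_add ad.poly_apply_pCons br_br_left
          br_add_right br_diff_right br_scale_right scale_right_distrib scale_right_diff_distrib
          u_def[symmetric] u'_def[symmetric] algebra_simps)
    show ?case unfolding eq
    proof (rule subspace_diff[OF W(1) subspace_add[OF W(1)]])
      show "scale a (br y e - scale \<nu> e) \<in> W" using e(3) subspace_scale[OF W(1)] by blast
      show "br x (br y u - scale \<nu> u + scale \<mu> u') \<in> W"
        using pCons.IH x(2) by (simp add: u_def u'_def)
      show "br (br x y) u - scale \<mu> u \<in> W" using z in_U by (simp add: u_def)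
    qed
  qed
  have "br y (poly_apply (br x) p e) - scale \<nu> (poly_apply (br x) p e) \<in> W"
    using p(2) y(2) subspace_scale[OF W(1)] subspace_diff[OF W(1)] by blast
  with key[of p] have "scale \<mu> (poly_apply (br x) (pderiv p) e) \<in> W"
    using subspace_diff[OF W(1)] by fastforce
  then have "scale (inverse \<mu>) (scale \<mu> (poly_apply (br x) (pderiv p) e)) \<in> W"
    using subspace_scale[OF W(1)] by blast
  with \<open>\<mu> \<noteq> 0\<close> have p': "poly_apply (br x) (pderiv p) e \<in> W" by simp
  show False
  proof (cases "degree p = 0")
    case True
    then obtain c where c: "p = [:c:]" by (metis degree_eq_zeroE)
    then have "scale c e \<in> W" "c \<noteq> 0"
      using p by (auto simp: ad.poly_apply_pCons ad.poly_apply_0 br_zero_right)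
    then have "scale (inverse c) (scale c e) \<in> W" using subspace_scale[OF W(1)] by blast
    then show False using e \<open>c \<noteq> 0\<close> by simp
  next
    case False
    then have "pderiv p \<noteq> 0" by (simp add: pderiv_eq_0_iff)
    then show False using p(3)[OF _ p'] False by (simp add: degree_pderiv)
  qed
qed

text \<open>Let \<open>W\<close> be a maximal \<open>G\<close>-stable subspace on which
  \<open>z = br x y\<close> is nilpotent. If \<open>W\<close> were proper, \<open>I\<close> would
  act as zero on some larger \<open>U\<close> modulo \<open>W\<close>, so that \<open>z\<close>
  would commute there with \<open>G\<close>. An eigenspace of \<open>z\<close> on it is then
  \<open>G\<close>-stable, and a commutator can only be the scalar zero there, so \<open>W\<close>
  could be enlarged.\<close>

lemma ad_nilpotent_commutator:
  assumes G: "subalgebra G" and I: "I \<subseteq> G" "\<And>g x. g \<in> G \<Longrightarrow> x \<in> I \<Longrightarrow> br g x \<in> I"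
    "acts_nilpotently G I"
    and xy: "x \<in> G" "y \<in> G" "\<And>g. g \<in> G \<Longrightarrow> br g (br x y) \<in> I"
  shows "ad_nilpotent G (br x y)"
proof -
  define z where "z = br x y"
  obtain T where T: "finite T" "G \<subseteq> span T" using G by (auto simp: subalgebra_def)
  have subG: "subspace G" and closed: "\<And>x y. x \<in> G \<Longrightarrow> y \<in> G \<Longrightarrow> br x y \<in> G"
    using G by (auto simp: subalgebra_def)
  have zG: "z \<in> G" using xy closed by (simp add: z_def)
  define Q where "Q W \<longleftrightarrow> subspace W \<and> W \<subseteq> G \<and> (\<forall>g\<in>G. \<forall>w\<in>W. br g w \<in> W) \<and> ad_nilpotent W z" for W
  have "Q {0}" using subspace_0[OF subG]
    by (auto simp: Q_def br_zero_right ad_nilpotent_def intro: exI[of _ 0])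
  obtain W where W: "Q W" "\<And>W'. Q W' \<Longrightarrow> W \<subseteq> W' \<Longrightarrow> W' = W"
  proof (rule ex_maximal_subspace[of Q "{0}" G T])
    show "subspace W \<and> W \<subseteq> G" if "Q W" for W using that by (auto simp: Q_def)
  qed (use T \<open>Q {0}\<close> in blast)+
  have sW: "subspace W" and WG: "W \<subseteq> G" and Winv: "\<And>g w. g \<in> G \<Longrightarrow> w \<in> W \<Longrightarrow> br g w \<in> W"
    and Wnil: "\<And>w. w \<in> W \<Longrightarrow> \<exists>n. (br z ^^ n) w = 0"
    using W(1) by (auto simp: Q_def ad_nilpotent_def)
  have "W = G"
  proof (rule ccontr)
    assume "W \<noteq> G"
    then have "W \<subset> G" using WG by blast
    obtain u0 where u0: "u0 \<in> G" "u0 \<notin> W" "\<And>x. x \<in> I \<Longrightarrow> br x u0 \<in> W"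
      using acts_nilpotentlyD[OF I(3) subG sW \<open>W \<subset> G\<close>] I(1) closed Winv by blast
    define U where "U = {u \<in> G. \<forall>x\<in>I. br x u \<in> W}"
    have sU: "subspace U"
      using sW subG unfolding U_def
      by (auto simp: subspace_def br_add_right br_scale_right br_zero_right)
    have Uinv: "br g u \<in> U" if "g \<in> G" "u \<in> U" for g u
    proof -
      have "br x (br g u) \<in> W" if x: "x \<in> I" for x
      proof -
        have "br g (br x u) \<in> W" "br (br g x) u \<in> W"
          using \<open>u \<in> U\<close> \<open>g \<in> G\<close> x Winv I(2) unfolding U_def by auto
        moreover have "br x (br g u) = br g (br x u) - br (br g x) u" by (simp add: br_br_left)
        ultimately show ?thesis using subspace_diff[OF sW] by simp
      qed
      then show ?thesis using that closed unfolding U_def by auto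
    qed
    have WU: "W \<subset> U" using WG Winv I(1) u0 unfolding U_def by blast
    have UG: "U \<subseteq> G" "U \<subseteq> span T" using T unfolding U_def by auto
    obtain e \<mu> where e: "e \<in> U" "e \<notin> W" "br z e - scale \<mu> e \<in> W"
      using ac_ad.ex_eigenvector_mod[OF sU _ UG(2) T(1) sW WU, of z] Uinv zG by blast
    \<comment> \<open>The \<open>\<mu>\<close>-eigenspace of \<open>z\<close> on \<open>U\<close>
      modulo \<open>W\<close>. It is stable under \<open>x\<close> and \<open>y\<close>, so that
      \<open>commutator_not_scalar\<close> applies to it.\<close>
    define E where "E = {u \<in> U. br z u - scale \<mu> u \<in> W}"
    have sE: "subspace E"
    proof (rule subspaceI)
      show "0 \<in> E" using subspace_0[OF sU] subspace_0[OF sW] by (simp add: E_def br_zero_right)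
      show "u + v \<in> E" if "u \<in> E" "v \<in> E" for u v
      proof -
        have "br z (u + v) - scale \<mu> (u + v) = (br z u - scale \<mu> u) + (br z v - scale \<mu> v)"
          by (simp add: br_add_right scale_right_distrib)
        with that show ?thesis
          unfolding E_def by (simp add: subspace_add[OF sU] subspace_add[OF sW])
      qed
      show "scale c u \<in> E" if "u \<in> E" for c u
      proof -
        have "br z (scale c u) - scale \<mu> (scale c u) = scale c (br z u - scale \<mu> u)"
          by (simp add: br_scale_right scale_right_diff_distrib mult.commute)
        with that show ?thesis
          unfolding E_def by (simp add: subspace_scale[OF sU] subspace_scale[OF sW])
      qed
    qed
    have Einv: "br g u \<in> E" if "g \<in> G" "u \<in> E" for g u
    proof -
      have u: "u \<in> U" "br z u - scale \<mu> u \<in> W" using that by (auto simp: E_def)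
      have "br z (br g u) - scale \<mu> (br g u) = br g (br z u - scale \<mu> u) - br (br g z) u"
        by (simp add: br_br_left br_diff_right br_scale_right)
      moreover have "br g (br z u - scale \<mu> u) \<in> W" using u Winv that by blast
      moreover have "br (br g z) u \<in> W" using u xy(3)[OF that(1)] by (simp add: U_def z_def)
      ultimately have "br z (br g u) - scale \<mu> (br g u) \<in> W" using subspace_diff[OF sW] by simp
      then show ?thesis using Uinv that u by (simp add: E_def)
    qed
    have "W \<subseteq> E" using WU Winv zG subspace_diff[OF sW] subspace_scale[OF sW] unfolding E_def by blast
    then have WE: "W \<subset> E" using e unfolding E_def by blast
    have EG: "E \<subseteq> G" using UG by (auto simp: E_def)
    have "\<mu> = 0"
    proof (rule commutator_not_scalar[OF sE _ T(1) sW WE, of x y])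
      show "E \<subseteq> span T" using EG T by blast
    qed (use Einv Winv xy in \<open>auto simp: E_def z_def\<close>)
    have "ad_nilpotent E z"
      unfolding ad_nilpotent_def
    proof
      fix u assume "u \<in> E"
      then have "br z u \<in> W" using \<open>\<mu> = 0\<close> by (simp add: E_def)
      then obtain n where "(br z ^^ n) (br z u) = 0" using Wnil by blast
      then have "(br z ^^ Suc n) u = 0" by (simp add: funpow_swap1)
      then show "\<exists>n. (br z ^^ n) u = 0" by blast
    qed
    then have "Q E" using sE EG Einv by (simp add: Q_def)
    then show False using W(2) WE by blast
  qed
  then show ?thesis using Wnil unfolding ad_nilpotent_def z_def by blast
qed

text \<open>The spanning elements \<open>br x y\<close> of this term are commutators and central
  modulo the next term, hence ad-nilpotent, and can be adjoined to the next term.\<close>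

lemma acts_nilpotently_lower_central_Suc:
  assumes G: "subalgebra G" and "acts_nilpotently G (lower_central G (Suc (Suc j)))"
  shows "acts_nilpotently G (lower_central G (Suc j))"
proof -
  let ?I = "lower_central G (Suc (Suc j))"
  define S where "S = {br x y |x y. x \<in> G \<and> y \<in> lower_central G j}"
  have S: "span S = lower_central G (Suc j)" by (simp add: S_def lower_central_Suc)
  then have SC: "S \<subseteq> lower_central G (Suc j)" using span_superset by blast
  have CG: "lower_central G i \<subseteq> G" for i by (rule lower_central_subset[OF G])
  have IC: "?I \<subseteq> lower_central G (Suc j)" by (rule lower_central_decreasing[OF G])
  obtain T where T: "finite T" "G \<subseteq> span T" using G by (auto simp: subalgebra_def)
  have "acts_nilpotently G (span (?I \<union> S))"
  proof (rule acts_nilpotently_extend[OF _ T(1) assms(2)])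
    show "S \<subseteq> span T" using SC CG T by blast
    show "br z x \<in> span ?I" if "z \<in> S" "x \<in> ?I \<union> S" for z x
      using that SC CG IC br_in_lower_central[of z G x "Suc j"] by (intro span_base) blast
    show "ad_nilpotent G z" if "z \<in> S" for z
    proof -
      obtain x y where z: "z = br x y" "x \<in> G" "y \<in> lower_central G j" using \<open>z \<in> S\<close> by (auto simp: S_def)
      show ?thesis unfolding z(1)
      proof (rule ad_nilpotent_commutator[OF G CG _ assms(2) z(2)])
        show "br g x \<in> ?I" if "g \<in> G" "x \<in> ?I" for g x
          using that br_in_lower_central[of g G x "Suc j"] IC by blast
        show "y \<in> G" using z CG by blast
        show "br g (br x y) \<in> ?I" if "g \<in> G" for g
          using that z by (intro br_in_lower_central)
      qed
    qed
  qed
  moreover have "span (?I \<union> S) = span S"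
    unfolding span_eq using IC S span_superset[of S] span_superset[of "?I \<union> S"] by blast
  ultimately show ?thesis using S by simp
qed

text \<open>Lowering the index from \<open>N\<close> reaches the derived algebra. The elements of
  \<open>G\<close> still to be added need not be commutators, so their ad-nilpotency comes from
  \<open>S\<close>; modulo the derived algebra they commute and can be adjoined.\<close>

lemma acts_nilpotently_of_spanning:
  assumes G: "subalgebra G" and "acts_nilpotently G (lower_central G N)"
    and S: "S \<subseteq> G" "G \<subseteq> span S" "\<And>s. s \<in> S \<Longrightarrow> ad_nilpotent G s"
  shows "acts_nilpotently G G"
proof (cases N)
  case 0
  then show ?thesis using assms(1,2) by (simp add: lower_central_0 subalgebra_def)
next
  case (Suc N')
  let ?I = "lower_central G (Suc 0)"
  have "acts_nilpotently G (lower_central G (Suc N'))" using assms(2) Suc by simp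
  then have I: "acts_nilpotently G ?I"
    by (induction N') (auto dest: acts_nilpotently_lower_central_Suc[OF G])
  obtain T where T: "finite T" "G \<subseteq> span T" using G by (auto simp: subalgebra_def)
  have sG: "subspace G" using G by (simp add: subalgebra_def)
  have IG: "?I \<subseteq> G" by (rule lower_central_subset[OF G])
  have "acts_nilpotently G (span (?I \<union> S))"
  proof (rule acts_nilpotently_extend[OF _ T(1) I])
    show "S \<subseteq> span T" using S T by blast
    show "br z x \<in> span ?I" if "z \<in> S" "x \<in> ?I \<union> S" for z x
      using that S(1) IG br_in_lower_central[of z G x 0] lower_central_0[OF sG]
      by (intro span_base) blast
  qed (rule S(3))
  moreover have "span (?I \<union> S) = G"
    using IG S sG span_minimal[of "?I \<union> S" G] span_mono[of S "?I \<union> S"] by blast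
  ultimately show ?thesis by simp
qed

end

section \<open>Leibniz-derivations\<close>

context lie
begin

text \<open>The bracket on \<open>g[\<epsilon>]/(\<epsilon>\<^sup>2)\<close>: the sums over all positions in the Leibniz rule are the
  \<open>\<epsilon>\<close>-components of iterated brackets of the elements \<open>x + \<epsilon> P x\<close>.\<close>

definition dual_br :: "'b \<times> 'b \<Rightarrow> 'b \<times> 'b \<Rightarrow> 'b \<times> 'b" where
  "dual_br x y = (br (fst x) (fst y), br (snd x) (fst y) + br (fst x) (snd y))"

lemma lie_dual: "lie (\<lambda>a x. (a *s fst x, a *s snd x)) dual_br"
proof
  fix x y z :: "'b \<times> 'b"
  \<comment> \<open>The \<open>\<epsilon>\<close>-component of the Jacobi identity is the sum of
    three Jacobi identities, each with one argument replaced by its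
    \<open>\<epsilon>\<close>-part.\<close>
  have "br (snd x) (br (fst y) (fst z)) + br (snd y) (br (fst z) (fst x)) +
      br (snd z) (br (fst x) (fst y)) + br (fst x) (br (snd y) (fst z)) +
      br (fst x) (br (fst y) (snd z)) + br (fst y) (br (snd z) (fst x)) +
      br (fst y) (br (fst z) (snd x)) + br (fst z) (br (snd x) (fst y)) +
      br (fst z) (br (fst x) (snd y)) = 0"
    using br_jacobi[of "snd x" "fst y" "fst z"] br_jacobi[of "fst x" "snd y" "fst z"]
      br_jacobi[of "fst x" "fst y" "snd z"]
    by (smt (verit) add.assoc add.commute add_0)
  then show "dual_br x (dual_br y z) + dual_br y (dual_br z x) + dual_br z (dual_br x y) = 0"
    using br_jacobi[of "fst x" "fst y" "fst z"]
    by (simp add: dual_br_def prod_eq_iff br_add_right algebra_simps)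
  show "dual_br x x = 0"
    using br_swap[of "snd x" "fst x"] by (simp add: dual_br_def prod_eq_iff br_self)
qed (auto simp: dual_br_def prod_eq_iff algebra_simps br_add_left br_add_right br_scale_left
    br_scale_right scale_right_distrib scale_left_distrib)

lemma foldr_dual_br:
  "foldr dual_br (map (\<lambda>x. (x, A x)) us) (v, B v) =
    (foldr br us v, foldr br us (B v) + (\<Sum>i<length us. foldr br (us[i := A (us ! i)]) v))"
proof (induction us)
  case (Cons u us)
  then show ?case
    by (simp add: dual_br_def sum.lessThan_Suc_shift ad.f_sum br_add_right algebra_simps
        del: sum.lessThan_Suc)
qed simp

lemma foldr_br_update:
  "i < length us \<Longrightarrow> foldr br (us[i := a - c *s b]) v =
    foldr br (us[i := a]) v - c *s foldr br (us[i := b]) v"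
  by (induction us arbitrary: i)
    (auto split: nat.split simp: br_diff_left br_scale_left br_diff_right br_scale_right)

end

section \<open>Leibniz rules relative to a subalgebra\<close>

locale lie_endo = lie scale br + P: vs_endo scale P
  for scale :: "'a::field_char_0 \<Rightarrow> 'b::ab_group_add \<Rightarrow> 'b" and br and P
begin

interpretation dual: lie "\<lambda>a x. (scale a (fst x), scale a (snd x))" dual_br
  by (rule lie_dual)

text \<open>The last of the \<open>k + 1\<close> entries is kept apart as \<open>v\<close> to suit
  \<open>foldr\<close>. The rule is relative to \<open>G\<close> so that it can be restricted to
  terms of the lower central series.\<close>

definition leibniz_on :: "'b set \<Rightarrow> nat \<Rightarrow> bool" where
  "leibniz_on G k \<longleftrightarrow> (\<forall>us v. length us = k \<longrightarrow> set us \<subseteq> G \<longrightarrow> v \<in> G \<longrightarrow>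
     P (foldr br us v) = foldr br us (P v) + (\<Sum>i<k. foldr br (us[i := P (us ! i)]) v))"

definition \<theta> :: "'b \<Rightarrow> 'b \<times> 'b" where "\<theta> x = (x, P x)"

lemma foldr_dual_theta:
  "foldr dual_br (map \<theta> us) (\<theta> v) =
    (foldr br us v, foldr br us (P v) + (\<Sum>i<length us. foldr br (us[i := P (us ! i)]) v))"
  using foldr_dual_br[of P us v P] by (simp add: \<theta>_def[abs_def])

text \<open>The right-hand side of the Leibniz rule is the \<open>\<epsilon>\<close>-component of
  one word in the dual numbers, so the rule says that \<open>\<theta>\<close> respects words with
  \<open>k\<close> brackets.\<close>

lemma leibniz_on_dual:
  assumes "leibniz_on G (length us)" "set us \<subseteq> G" "v \<in> G"
  shows "foldr dual_br (map \<theta> us) (\<theta> v) = \<theta> (foldr br us v)"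
  using assms unfolding foldr_dual_theta leibniz_on_def by (simp add: \<theta>_def)

text \<open>A left factor that is itself a word is expanded by
  \<open>[[x, n], w] = [x, [n, w]] - [n, [x, w]]\<close>: \<open>x\<close> moves to the end of
  \<open>ps\<close> or to the front of \<open>qs\<close>, the number of entries stays
  \<open>k + 1\<close>, and \<open>us\<close> shrinks.\<close>

lemma leibniz_on_nested:
  assumes "leibniz_on G k" "length ps + Suc (length us) + length qs = k"
    "set ps \<subseteq> G" "set us \<subseteq> G" "set qs \<subseteq> G" "u \<in> G" "v \<in> G"
  shows "foldr dual_br (map \<theta> ps) (dual_br (foldr dual_br (map \<theta> us) (\<theta> u)) (foldr dual_br (map \<theta> qs) (\<theta> v)))
    = \<theta> (foldr br ps (br (foldr br us u) (foldr br qs v)))"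
  using assms
proof (induction us arbitrary: ps qs)
  case Nil
  then show ?case using leibniz_on_dual[of G "ps @ u # qs" v] by simp
next
  case (Cons x us)
  let ?n = "foldr dual_br (map \<theta> us) (\<theta> u)" and ?w = "foldr dual_br (map \<theta> qs) (\<theta> v)"
  have "foldr dual_br (map \<theta> ps) (dual_br (foldr dual_br (map \<theta> (x # us)) (\<theta> u)) ?w)
      = foldr dual_br (map \<theta> (ps @ [x])) (dual_br ?n ?w)
        - foldr dual_br (map \<theta> ps) (dual_br ?n (foldr dual_br (map \<theta> (x # qs)) (\<theta> v)))"
    by (simp add: dual.br_br_left dual.foldr_br.f_diff)
  also have "\<dots> = \<theta> (foldr br (ps @ [x]) (br (foldr br us u) (foldr br qs v)))
      - \<theta> (foldr br ps (br (foldr br us u) (foldr br (x # qs) v)))"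
    by (subst (1 2) Cons.IH) (use Cons.prems in auto)
  also have "\<dots> = \<theta> (foldr br ps (br (foldr br (x # us) u) (foldr br qs v)))"
    by (simp add: \<theta>_def br_br_left foldr_br.f_diff P.f_diff)
  finally show ?case .
qed

lemma lower_central_perfect:
  assumes "subspace G" "lower_central G (Suc 0) = G" shows "lower_central G j = G"
proof (induction j)
  case 0
  then show ?case using lower_central_0[OF assms(1)] .
next
  case (Suc j)
  then show ?case
    using assms(2) lower_central_0[OF assms(1)] by (simp add: lower_central_Suc)
qed

text \<open>A perfect algebra is spanned by words of any prescribed length. Words with
  \<open>k - 1\<close> brackets serve twice: to describe \<open>[P, ad x]\<close> for every
  \<open>x\<close>, and to see that \<open>br (c x)\<close> vanishes on all of
  \<open>G\<close>.\<close>

lemma derivation_of_perfect: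
  assumes G: "subalgebra G" and perfect: "lower_central G (Suc 0) = G" and PG: "\<And>x. x \<in> G \<Longrightarrow> P x \<in> G"
    and k: "k \<ge> 1" and leib: "leibniz_on G k"
  shows "leibniz_on G 1"
proof -
  have sG: "subspace G" and closed: "\<And>x y. x \<in> G \<Longrightarrow> y \<in> G \<Longrightarrow> br x y \<in> G"
    using G by (auto simp: subalgebra_def)
  have foldr_in: "foldr br us v \<in> G" if "set us \<subseteq> G" "v \<in> G" for us v
    using foldr_br_in[of G G, OF closed] that by blast
  have gen: "span {foldr br us v |us v. length us = j \<and> set us \<subseteq> G \<and> v \<in> G} = G" for j
    using lower_central_perfect[OF sG perfect, of j] by (simp add: lower_central_def)
  \<comment> \<open>The elements \<open>x\<close> for which \<open>[P, ad x]\<close> is inner on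
    \<open>G\<close>. Words with \<open>k - 1\<close> brackets belong to \<open>Y\<close>, because
    bracketing them with one more element brings the count to \<open>k\<close>.\<close>
  define Y where "Y = {x \<in> G. \<exists>c\<in>G. \<forall>y\<in>G. P (br x y) = br c y + br x (P y)}"
  have "subspace Y"
  proof (rule subspaceI)
    show "0 \<in> Y"
      using subspace_0[OF sG] by (auto simp: Y_def br_zero_left P.f_zero intro!: bexI[of _ 0])
    show "x + x' \<in> Y" if "x \<in> Y" "x' \<in> Y" for x x'
    proof -
      from that obtain c c' where "c \<in> G" "\<forall>y\<in>G. P (br x y) = br c y + br x (P y)"
          "c' \<in> G" "\<forall>y\<in>G. P (br x' y) = br c' y + br x' (P y)" by (auto simp: Y_def)
      then have "c + c' \<in> G" "\<forall>y\<in>G. P (br (x + x') y) = br (c + c') y + br (x + x') (P y)"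
        using subspace_add[OF sG] by (auto simp: br_add_left P.f_add)
      then show ?thesis using that subspace_add[OF sG] by (auto simp: Y_def)
    qed
    show "scale a x \<in> Y" if "x \<in> Y" for a x
    proof -
      from that obtain c where "c \<in> G" "\<forall>y\<in>G. P (br x y) = br c y + br x (P y)"
        by (auto simp: Y_def)
      then have "scale a c \<in> G" "\<forall>y\<in>G. P (br (scale a x) y) = br (scale a c) y + br (scale a x) (P y)"
        using subspace_scale[OF sG] by (auto simp: br_scale_left P.f_scale scale_right_distrib)
      then show ?thesis using that subspace_scale[OF sG] by (auto simp: Y_def)
    qed
  qed
  moreover have "foldr br us u \<in> Y" if us: "length us = k - 1" "set us \<subseteq> G" "u \<in> G" for us u
  proof -
    let ?c = "foldr br us (P u) + (\<Sum>i<length us. foldr br (us[i := P (us ! i)]) u)"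
    have "?c \<in> G"
    proof (intro subspace_add[OF sG] subspace_sum[OF sG] foldr_in)
      show "set (us[i := P (us ! i)]) \<subseteq> G" if "i \<in> {..<length us}" for i
        using that us PG set_update_subset_insert[of us i "P (us ! i)"] nth_mem[of i us] by blast
    qed (use us PG in auto)
    moreover have "P (br (foldr br us u) y) = br ?c y + br (foldr br us u) (P y)" if "y \<in> G" for y
      using leibniz_on_nested[OF leib, of "[]" us "[]" u y] us that k
      by (simp add: foldr_dual_theta) (simp add: \<theta>_def dual_br_def)
    ultimately show ?thesis using foldr_in us by (auto simp: Y_def)
  qed
  ultimately have "span {foldr br us v |us v. length us = k - 1 \<and> set us \<subseteq> G \<and> v \<in> G} \<subseteq> Y"
    by (intro span_minimal) auto
  then have "G \<subseteq> Y" by (simp only: gen)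
  then have "\<forall>x. \<exists>c. x \<in> G \<longrightarrow> c \<in> G \<and> (\<forall>y\<in>G. P (br x y) = br c y + br x (P y))"
    unfolding Y_def by blast
  then obtain d where d: "\<And>x. x \<in> G \<Longrightarrow> d x \<in> G"
      "\<And>x y. x \<in> G \<Longrightarrow> y \<in> G \<Longrightarrow> P (br x y) = br (d x) y + br x (P y)"
    by metis
  \<comment> \<open>\<open>d\<close> is obtained by choice and determined only up to elements
    centralising \<open>G\<close>, so the identities for \<open>c\<close> are stated under a
    bracket.\<close>
  define c where "c x = d x - P x" for x
  have cG: "c x \<in> G" if "x \<in> G" for x using that d PG subspace_diff[OF sG] by (simp add: c_def)
  have Pbr: "P (br x y) = br (P x) y + br x (P y) + br (c x) y" if "x \<in> G" "y \<in> G" for x y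
    using d(2)[OF that] by (simp add: c_def br_diff_left)
  text \<open>\<open>c\<close> is an element of the centroid, up to the centre.\<close>
  have c_swap: "br (c x) y = br x (c y)" if "x \<in> G" "y \<in> G" for x y
  proof -
    have "br (P x) y + br x (P y) + br (c x) y = - (br (P y) x + br y (P x) + br (c y) x)"
      using Pbr[OF that] Pbr[of y x] that br_swap[of x y] by (simp add: P.f_minus)
    then have "br (c x) y + br (c y) x = 0"
      using br_swap[of "P x" y] br_swap[of x "P y"] by (simp add: algebra_simps)
    then show ?thesis
      using br_swap[of x "c y"] by (metis eq_neg_iff_add_eq_0)
  qed
  \<comment> \<open>\<open>P\<close> applied to both sides of the Jacobi identity shows that
    \<open>d\<close> is a derivation up to the centre; rewriting with \<open>d = P + c\<close> gives
    the claim.\<close>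
  have c_br: "br w (c (br x y)) = br w (br x (c y))" if "x \<in> G" "y \<in> G" "w \<in> G" for x y w
  proof -
    have "P (br (br x y) w) = P (br x (br y w)) - P (br y (br x w))"
      by (simp only: br_br_left P.f_diff)
    moreover have "P (br (br x y) w) = br (d (br x y)) w + br (br x y) (P w)"
      "P (br x (br y w)) = br (d x) (br y w) + br x (br (d y) w + br y (P w))"
      "P (br y (br x w)) = br (d y) (br x w) + br y (br (d x) w + br x (P w))"
      using that closed by (simp_all only: d(2))
    ultimately have "br (d (br x y)) w + br (br x y) (P w)
      = br (d x) (br y w) + br x (br (d y) w + br y (P w))
        - (br (d y) (br x w) + br y (br (d x) w + br x (P w)))" by (simp only:)
    then have "br (d (br x y)) w = br (br (d x) y) w + br (br x (d y)) w"
      by (simp add: br_br_left br_add_right algebra_simps)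
    then have "br (d (br x y) - br (d x) y - br x (d y)) w = 0"
      by (simp add: br_diff_left)
    moreover have "d (br x y) - br (d x) y - br x (d y) = c (br x y) - br x (c y)"
      using d(2)[OF that(1,2)] by (simp add: c_def br_diff_right)
    ultimately show ?thesis
      using br_swap[of w "c (br x y)"] br_swap[of w "br x (c y)"] by (simp add: br_diff_left)
  qed
  \<comment> \<open>Each of the \<open>Suc (length us)\<close> brackets contributes one correction
    by \<open>c\<close>, and the centroid property moves it to the leftmost factor.\<close>
  have defect: "P (foldr br (x # us) v) = snd (foldr dual_br (map \<theta> (x # us)) (\<theta> v))
      + scale (of_nat (Suc (length us))) (br (c x) (foldr br us v))"
    if "x \<in> G" "set us \<subseteq> G" "v \<in> G" for x us v
    using that
  proof (induction us arbitrary: x)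
    case Nil
    then show ?case using Pbr[of x v] by (simp add: dual_br_def \<theta>_def)
  next
    case (Cons x' us)
    define f where "f = foldr br us v"
    have fG: "f \<in> G" "x' \<in> G" using Cons.prems foldr_in by (auto simp: f_def)
    have eq: "br x (br (c x') f) = br (c x) (br x' f)"
      using c_swap[of x' f] c_swap[of x "br x' f"] c_br[of x' f x] fG Cons.prems closed by simp
    have "P (br x (br x' f)) = br (P x) (br x' f) + br x (P (br x' f)) + br (c x) (br x' f)"
      using Pbr[of x "br x' f"] fG Cons.prems closed by simp
    moreover define D where "D = foldr dual_br (map \<theta> (x' # us)) (\<theta> v)"
    have "P (br x' f) = snd D + scale (of_nat (Suc (length us))) (br (c x') f)"
      using Cons.IH[of x'] Cons.prems by (simp add: f_def D_def)
    ultimately have "P (br x (br x' f)) = br (P x) (br x' f) + br x (snd D)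
        + scale (of_nat (Suc (Suc (length us)))) (br (c x) (br x' f))"
      using eq scale_left_distrib[of 1 1 "br (c x) (br x' f)"]
      by (simp add: br_add_right br_scale_right scale_left_distrib algebra_simps)
    moreover have "fst D = br x' f"
      unfolding D_def foldr_dual_theta by (simp add: f_def)
    then have "snd (dual_br (\<theta> x) D) = br (P x) (br x' f) + br x (snd D)"
      by (simp add: dual_br_def \<theta>_def)
    ultimately show ?case by (simp add: f_def D_def)
  qed
  have "br (c x) y = 0" if x: "x \<in> G" and y: "y \<in> G" for x y
  proof -
    \<comment> \<open>\<open>x # us\<close> has exactly \<open>k\<close> entries, so the Leibniz
      rule holds for this word and \<open>k\<close> times the correction is zero; characteristic
      zero removes the factor.\<close>
    have "br (c x) (foldr br us v) = 0" if us: "length us = k - 1" "set us \<subseteq> G" "v \<in> G" for us v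
    proof -
      have "snd (foldr dual_br (map \<theta> (x # us)) (\<theta> v)) = P (foldr br (x # us) v)"
        using leibniz_on_dual[of G "x # us" v] leib us x k by (simp add: \<theta>_def)
      then have "scale (of_nat (Suc (length us))) (br (c x) (foldr br us v)) = 0"
        using defect[OF x us(2,3)] by simp
      then show ?thesis by (simp del: of_nat_Suc)
    qed
    then show ?thesis
      using span_br_right[of "{0}" "{foldr br us v |us v. length us = k - 1 \<and> set us \<subseteq> G \<and> v \<in> G}" "c x" y]
        y gen by auto
  qed
  then have "P (br x y) = br x (P y) + br (P x) y" if "x \<in> G" "y \<in> G" for x y
    using Pbr[OF that] that by (simp add: add.commute)
  then show ?thesis
    by (auto simp: leibniz_on_def length_Suc_conv lessThan_Suc)
qed

text \<open>The Leibniz rule is applied to the leading \<open>k\<close> entries of a word: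
  \<open>P\<close> falls on one of them or on the tail, which the induction hypothesis covers. Hence
  the indices divisible by \<open>k\<close>.\<close>

lemma lower_central_mult_invariant:
  assumes G: "subalgebra G" and PG: "\<And>x. x \<in> G \<Longrightarrow> P x \<in> G" and leib: "leibniz_on G k"
  shows "x \<in> lower_central G (k * m) \<Longrightarrow> P x \<in> lower_central G (k * m)"
proof (induction m arbitrary: x)
  case 0
  then show ?case using G PG by (simp add: lower_central_0 subalgebra_def)
next
  case (Suc m)
  let ?C = "lower_central G (k * Suc m)"
  have "subspace {x. P x \<in> ?C}"
    using subspace_lower_central[of G "k * Suc m"]
    by (auto simp: subspace_def P.f_add P.f_scale P.f_zero)
  moreover have "{foldr br us v |us v. length us = k * Suc m \<and> set us \<subseteq> G \<and> v \<in> G} \<subseteq> {x. P x \<in> ?C}"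
  proof safe
    fix us :: "'b list" and v assume us: "length us = k * Suc m" "set us \<subseteq> G" "v \<in> G"
    define xs where "xs = take k us"
    define y where "y = foldr br (drop k us) v"
    have f: "foldr br us v = foldr br xs y"
      unfolding xs_def y_def by (subst append_take_drop_id[of k us, symmetric], subst foldr_append) simp
    have xs: "length xs = k" "set xs \<subseteq> G"
      using us set_take_subset[of k us] by (auto simp: xs_def)
    have y: "y \<in> lower_central G (k * m)"
      unfolding y_def lower_central_def using us set_drop_subset[of k us]
      by (intro span_base CollectI exI[of _ "drop k us"] exI[of _ v]) auto
    have yG: "y \<in> G" using y lower_central_subset[OF G] by blast
    have mem: "foldr br ys w \<in> ?C" if "length ys = k" "set ys \<subseteq> G" "w \<in> lower_central G (k * m)" for ys w
      using foldr_br_in_lower_central[OF that(2,3)] that(1) by simp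
    have "foldr br xs (P y) + (\<Sum>i<k. foldr br (xs[i := P (xs ! i)]) y) \<in> ?C"
    proof (intro subspace_add subspace_sum subspace_lower_central mem)
      show "set (xs[i := P (xs ! i)]) \<subseteq> G" if "i \<in> {..<k}" for i
        using that xs PG set_update_subset_insert[of xs i "P (xs ! i)"] nth_mem[of i xs] by blast
    qed (use xs y Suc.IH in auto)
    then show "P (foldr br us v) \<in> ?C"
      unfolding f using leib xs yG by (simp add: leibniz_on_def)
  qed
  ultimately show ?case
    using Suc.prems span_minimal unfolding lower_central_def[of G "k * Suc m"] by blast
qed

end

section \<open>Invertible Leibniz-derivations over an algebraically closed field\<close>

locale ac_lie_endo = ac_lie scale br + lie_endo scale br P
  for scale :: "'a::{alg_closed_field,field_char_0} \<Rightarrow> 'b::ab_group_add \<Rightarrow> 'b" and br and P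
begin

sublocale ac_P: ac_vs_endo scale P ..

section \<open>Generalised eigenspaces of \<open>P\<close>\<close>

definition shifted :: "'a \<Rightarrow> 'b \<Rightarrow> 'b" where "shifted \<nu> v = P v - scale \<nu> v"

sublocale shifted: vs_endo scale "shifted \<nu>" for \<nu>
proof
  show "shifted \<nu> (x + y) = shifted \<nu> x + shifted \<nu> y" for x y
    by (simp add: shifted_def P.f_add scale_right_distrib)
  show "shifted \<nu> (scale a x) = scale a (shifted \<nu> x)" for a x
    by (simp add: shifted_def P.f_scale scale_right_diff_distrib scale_left_commute)
qed

sublocale shifted_pow: vs_endo scale "shifted \<nu> ^^ n" for \<nu> n
proof
  show "(shifted \<nu> ^^ n) (x + y) = (shifted \<nu> ^^ n) x + (shifted \<nu> ^^ n) y" for x y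
    by (induction n) (auto simp: shifted.f_add)
  show "(shifted \<nu> ^^ n) (scale a x) = scale a ((shifted \<nu> ^^ n) x)" for a x
    by (induction n) (auto simp: shifted.f_scale)
qed

definition gen_eigenvector :: "'a \<Rightarrow> 'b \<Rightarrow> bool" where
  "gen_eigenvector \<nu> v \<longleftrightarrow> (\<exists>n. (shifted \<nu> ^^ n) v = 0)"

lemma shifted_pow_eq_0_mono:
  assumes "(shifted \<nu> ^^ m) v = 0" "m \<le> n" shows "(shifted \<nu> ^^ n) v = 0"
proof -
  have "(shifted \<nu> ^^ n) v = (shifted \<nu> ^^ (n - m)) ((shifted \<nu> ^^ m) v)"
    using assms(2) by (simp flip: funpow_add comp_apply[of "shifted \<nu> ^^ (n - m)"])
  then show ?thesis using assms(1) by (simp add: shifted_pow.f_zero)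
qed

lemma subspace_gen_eigenvector: "subspace {v. gen_eigenvector \<nu> v}"
proof (rule subspaceI; safe)
  show "gen_eigenvector \<nu> 0"
    unfolding gen_eigenvector_def by (rule exI[of _ 0]) simp
  fix x y assume "gen_eigenvector \<nu> x" "gen_eigenvector \<nu> y"
  then obtain m n where "(shifted \<nu> ^^ m) x = 0" "(shifted \<nu> ^^ n) y = 0"
    by (auto simp: gen_eigenvector_def)
  then have "(shifted \<nu> ^^ max m n) (x + y) = 0"
    using shifted_pow_eq_0_mono[of m \<nu> x "max m n"] shifted_pow_eq_0_mono[of n \<nu> y "max m n"]
    by (simp add: shifted_pow.f_add)
  then show "gen_eigenvector \<nu> (x + y)" by (auto simp: gen_eigenvector_def)
next
  fix c x assume "gen_eigenvector \<nu> x"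
  then show "gen_eigenvector \<nu> (scale c x)"
    by (auto simp: gen_eigenvector_def shifted_pow.f_scale)
qed

lemma gen_eigenvector_shifted: "gen_eigenvector \<nu> (shifted \<nu> v) \<Longrightarrow> gen_eigenvector \<nu> v"
proof -
  assume "gen_eigenvector \<nu> (shifted \<nu> v)"
  then obtain n where "(shifted \<nu> ^^ n) (shifted \<nu> v) = 0" by (auto simp: gen_eigenvector_def)
  then have "(shifted \<nu> ^^ Suc n) v = 0" by (simp add: funpow_swap1)
  then show ?thesis unfolding gen_eigenvector_def by blast
qed

text \<open>With \<open>k = length us\<close>, \<open>P - (k \<nu> + \<mu>)\<close> acts on a word
  as the sum of \<open>P - \<nu>\<close> in each leading slot and \<open>P - \<mu>\<close> in the
  last. Every summand lowers one nilpotency exponent, which allows induction on their sum.\<close>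

lemma gen_eigenvector_foldr:
  assumes leib: "leibniz_on G (length us)" and G: "subspace G" "\<And>x. x \<in> G \<Longrightarrow> P x \<in> G"
    and us: "set us \<subseteq> G" "\<And>u. u \<in> set us \<Longrightarrow> gen_eigenvector \<nu> u"
    and v: "v \<in> G" "gen_eigenvector \<mu> v"
  shows "gen_eigenvector (of_nat (length us) * \<nu> + \<mu>) (foldr br us v)"
proof -
  define k where "k = length us"
  define \<sigma> where "\<sigma> = of_nat k * \<nu> + \<mu>"
  have shifted_in: "shifted \<nu> x \<in> G" if "x \<in> G" for \<nu> x
    using that G subspace_diff[OF G(1)] subspace_scale[OF G(1)] by (simp add: shifted_def)
  have step: "shifted \<sigma> (foldr br us v) = foldr br us (shifted \<mu> v)
      + (\<Sum>i<k. foldr br (us[i := shifted \<nu> (us ! i)]) v)"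
    if "length us = k" "set us \<subseteq> G" "v \<in> G" for us v
  proof -
    have "foldr br (us[i := shifted \<nu> (us ! i)]) v
        = foldr br (us[i := P (us ! i)]) v - scale \<nu> (foldr br us v)" if "i < k" for i
      using that \<open>length us = k\<close> by (simp add: shifted_def foldr_br_update)
    then have "(\<Sum>i<k. foldr br (us[i := shifted \<nu> (us ! i)]) v)
        = (\<Sum>i<k. foldr br (us[i := P (us ! i)]) v) - scale (of_nat k * \<nu>) (foldr br us v)"
      by (simp add: sum_subtractf sum_constant_scale)
    moreover have "P (foldr br us v)
        = foldr br us (P v) + (\<Sum>i<k. foldr br (us[i := P (us ! i)]) v)"
      using leib that unfolding leibniz_on_def k_def by blast
    moreover have "shifted \<sigma> (foldr br us v)
        = P (foldr br us v) - scale (of_nat k * \<nu>) (foldr br us v) - scale \<mu> (foldr br us v)"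
      by (simp add: shifted_def \<sigma>_def scale_left_distrib)
    ultimately show ?thesis
      by (simp add: shifted_def[of \<mu>] foldr_br.f_diff foldr_br_scale)
  qed
  have "gen_eigenvector \<sigma> (foldr br us v)"
    if "length us = k" "set us \<subseteq> G" "v \<in> G" "length ns = k" "(shifted \<mu> ^^ m) v = 0"
      "\<And>i. i < k \<Longrightarrow> (shifted \<nu> ^^ (ns ! i)) (us ! i) = 0" for us v ns m
    using that
  proof (induction "sum_list ns + m" arbitrary: us v ns m rule: less_induct)
    case less
    note prems = less.prems
    have zero: "gen_eigenvector \<sigma> 0" using subspace_0[OF subspace_gen_eigenvector] by simp
    have "gen_eigenvector \<sigma> (foldr br us (shifted \<mu> v))"
    proof (cases m)
      case 0
      then show ?thesis using prems(5) zero by (simp add: shifted.f_zero foldr_br.f_zero)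
    next
      case (Suc m')
      then have "(shifted \<mu> ^^ m') (shifted \<mu> v) = 0" using prems(5) by (simp add: funpow_swap1)
      then show ?thesis using prems Suc shifted_in by (intro less.hyps[of ns m']) auto
    qed
    moreover have "gen_eigenvector \<sigma> (foldr br (us[i := shifted \<nu> (us ! i)]) v)" if i: "i < k" for i
    proof (cases "ns ! i")
      case 0
      then have "us ! i = 0" using prems(6)[OF i] by simp
      \<comment> \<open>The entry \<open>0\<close> is written as a difference so that
        \<open>foldr_br_update\<close> turns the word into a difference of two equal words.\<close>
      then have "us[i := shifted \<nu> (us ! i)] = us[i := 0 - scale 1 0]" by (simp add: shifted.f_zero)
      then have "foldr br (us[i := shifted \<nu> (us ! i)]) v = 0"
        using foldr_br_update[of i us 0 1 0 v] i prems(1) by simp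
      then show ?thesis using zero by simp
    next
      case (Suc n)
      show ?thesis
      proof (rule less.hyps[of "ns[i := n]" m])
        show "sum_list (ns[i := n]) + m < sum_list ns + m"
          using i prems(4) Suc elem_le_sum_list[of i ns] by (simp add: sum_list_update)
        show "set (us[i := shifted \<nu> (us ! i)]) \<subseteq> G"
          using i prems(1,2) shifted_in set_update_subset_insert[of us i "shifted \<nu> (us ! i)"]
            nth_mem[of i us] by blast
        show "(shifted \<nu> ^^ (ns[i := n] ! j)) (us[i := shifted \<nu> (us ! i)] ! j) = 0" if "j < k" for j
          using prems(1,4) prems(6)[OF that] Suc that i
          by (cases "i = j") (auto simp: funpow_swap1)
      qed (use prems in auto)
    qed
    ultimately have "gen_eigenvector \<sigma> (shifted \<sigma> (foldr br us v))"
      unfolding step[OF prems(1-3)]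
      using subspace_add[OF subspace_gen_eigenvector, of _ \<sigma>]
        subspace_sum[OF subspace_gen_eigenvector, of "{..<k}" _ \<sigma>] by auto
    then show ?case by (rule gen_eigenvector_shifted)
  qed note main = this
  define n where "n i = (SOME n. (shifted \<nu> ^^ n) (us ! i) = 0)" for i
  have n: "(shifted \<nu> ^^ n i) (us ! i) = 0" if "i < k" for i
    unfolding n_def
    by (rule someI_ex) (use us(2)[of "us ! i"] that in \<open>simp add: gen_eigenvector_def k_def\<close>)
  obtain m where "(shifted \<mu> ^^ m) v = 0" using v(2) by (auto simp: gen_eigenvector_def)
  then have "gen_eigenvector \<sigma> (foldr br us v)"
    using us(1) v(1) n by (intro main[of us v "map n [0..<k]" m]) (auto simp: k_def)
  then show ?thesis by (simp add: \<sigma>_def k_def)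
qed

text \<open>\<open>P - \<nu>\<close> is \<open>P - \<mu>\<close> plus the nonzero scalar
  \<open>\<mu> - \<nu>\<close>, hence invertible where \<open>P - \<mu>\<close> is nilpotent; the
  preimage is built by induction on the exponent.\<close>

lemma shifted_surj_gen_eigenvector:
  assumes "subspace M" "\<And>x. x \<in> M \<Longrightarrow> P x \<in> M" "\<mu> \<noteq> \<nu>"
    and "w \<in> M" "(shifted \<mu> ^^ n) w = 0"
  shows "\<exists>w0\<in>M. gen_eigenvector \<mu> w0 \<and> shifted \<nu> w0 = w"
  using assms(4,5)
proof (induction n arbitrary: w)
  case 0
  then show ?case
    using subspace_0[OF assms(1)] subspace_0[OF subspace_gen_eigenvector]
    by (auto simp: shifted.f_zero intro!: bexI[of _ 0])
next
  case (Suc n)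
  have "shifted \<mu> w \<in> M"
    using Suc.prems(1) assms(2) subspace_diff[OF assms(1)] subspace_scale[OF assms(1)]
    by (simp add: shifted_def)
  moreover have "(shifted \<mu> ^^ n) (shifted \<mu> w) = 0" using Suc.prems(2) by (simp add: funpow_swap1)
  ultimately obtain w1 where w1: "w1 \<in> M" "gen_eigenvector \<mu> w1" "shifted \<nu> w1 = shifted \<mu> w"
    using Suc.IH by blast
  define w0 where "w0 = scale (inverse (\<mu> - \<nu>)) (w - w1)"
  have "shifted \<nu> (w - w1) = scale (\<mu> - \<nu>) w"
    using w1(3) by (simp add: shifted.f_diff) (simp add: shifted_def scale_left_diff_distrib)
  then have "shifted \<nu> w0 = w" using assms(3) by (simp add: w0_def shifted.f_scale)
  moreover have "w0 \<in> M"
    unfolding w0_def using Suc.prems w1 subspace_diff[OF assms(1)] subspace_scale[OF assms(1)] by blast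
  moreover have "gen_eigenvector \<mu> w" using Suc.prems(2) unfolding gen_eigenvector_def by blast
  then have "gen_eigenvector \<mu> w0"
    using w1(2) subspace_diff[OF subspace_gen_eigenvector, of w \<mu> w1]
      subspace_scale[OF subspace_gen_eigenvector, of "w - w1" \<mu>] by (simp add: w0_def)
  ultimately show ?case by blast
qed

text \<open>An eigenvector \<open>e\<close> modulo the span \<open>?H\<close> has
  \<open>(P - \<nu>) e\<close> in \<open>?H\<close>. As \<open>P - \<nu>\<close> is onto on the
  generalised eigenspaces for other eigenvalues, subtracting a suitable element of \<open>?H\<close>
  turns \<open>e\<close> into a generalised eigenvector for \<open>\<nu>\<close>, so
  \<open>e\<close> was in \<open>?H\<close>.\<close>

lemma span_gen_eigenvectors:
  assumes M: "subspace M" "\<And>x. x \<in> M \<Longrightarrow> P x \<in> M" and T: "M \<subseteq> span T" "finite T"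
  shows "M \<subseteq> span {v \<in> M. \<exists>\<nu>. gen_eigenvector \<nu> v}" (is "M \<subseteq> ?H")
proof (rule ccontr)
  assume "\<not> M \<subseteq> ?H"
  moreover have HM: "?H \<subseteq> M" by (rule span_minimal) (use M in auto)
  ultimately have "?H \<subset> M" by blast
  then obtain e \<nu> where e: "e \<in> M" "e \<notin> ?H" "P e - scale \<nu> e \<in> ?H"
    using ac_P.ex_eigenvector_mod[OF M(1) _ T subspace_span, of "{v \<in> M. \<exists>\<nu>. gen_eigenvector \<nu> v}"] M(2)
    by blast
  \<comment> \<open>Vectors that are generalised eigenvectors for \<open>\<nu>\<close> up to the
    image of \<open>?H\<close> under \<open>shifted \<nu>\<close>; the aim is
    \<open>?H \<subseteq> Y\<close>.\<close>
  define Y where "Y = {w. \<exists>w0\<in>?H. gen_eigenvector \<nu> (w - shifted \<nu> w0)}"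
  have "subspace Y"
  proof (rule subspaceI)
    show "0 \<in> Y"
      using subspace_0[OF subspace_gen_eigenvector] span_zero
      by (auto simp: Y_def shifted.f_zero intro!: bexI[of _ 0])
    show "x + y \<in> Y" if xy: "x \<in> Y" "y \<in> Y" for x y
    proof -
      from xy obtain x0 y0 where "x0 \<in> ?H" "y0 \<in> ?H"
        and g: "gen_eigenvector \<nu> (x - shifted \<nu> x0)" "gen_eigenvector \<nu> (y - shifted \<nu> y0)"
        by (auto simp: Y_def)
      moreover have eq: "x + y - shifted \<nu> (x0 + y0) = (x - shifted \<nu> x0) + (y - shifted \<nu> y0)"
        by (simp add: shifted.f_add)
      have "gen_eigenvector \<nu> (x + y - shifted \<nu> (x0 + y0))"
        unfolding eq using subspace_add[OF subspace_gen_eigenvector, of _ \<nu>] g by simp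
      ultimately show ?thesis unfolding Y_def using span_add by blast
    qed
    show "scale c x \<in> Y" if x: "x \<in> Y" for c x
    proof -
      from x obtain x0 where "x0 \<in> ?H" and g: "gen_eigenvector \<nu> (x - shifted \<nu> x0)"
        by (auto simp: Y_def)
      moreover have eq: "scale c x - shifted \<nu> (scale c x0) = scale c (x - shifted \<nu> x0)"
        by (simp add: shifted.f_scale scale_right_diff_distrib)
      have "gen_eigenvector \<nu> (scale c x - shifted \<nu> (scale c x0))"
        unfolding eq using subspace_scale[OF subspace_gen_eigenvector, of _ \<nu>] g by simp
      ultimately show ?thesis unfolding Y_def using span_scale by blast
    qed
  qed
  moreover have "w \<in> Y" if w: "w \<in> M" "gen_eigenvector \<mu> w" for w \<mu>
  proof (cases "\<mu> = \<nu>")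
    case True
    then show ?thesis
      using w span_zero by (auto simp: Y_def shifted.f_zero intro!: bexI[of _ 0])
  next
    case False
    obtain n where "(shifted \<mu> ^^ n) w = 0" using w(2) by (auto simp: gen_eigenvector_def)
    then obtain w0 where w0: "w0 \<in> M" "gen_eigenvector \<mu> w0" "shifted \<nu> w0 = w"
      using shifted_surj_gen_eigenvector[OF M False w(1)] by blast
    then have "w0 \<in> ?H" by (intro span_base) blast
    then show ?thesis
      using w0(3) subspace_0[OF subspace_gen_eigenvector] unfolding Y_def
      by (intro CollectI bexI[of _ w0]) auto
  qed
  ultimately have "?H \<subseteq> Y" by (intro span_minimal) auto
  then obtain w0 where w0: "w0 \<in> ?H" "gen_eigenvector \<nu> (shifted \<nu> e - shifted \<nu> w0)"
    using e(3) unfolding Y_def shifted_def by blast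
  then have "gen_eigenvector \<nu> (e - w0)"
    by (intro gen_eigenvector_shifted[of \<nu> "e - w0"]) (simp add: shifted.f_diff)
  moreover have "e - w0 \<in> M" using e w0 HM subspace_diff[OF M(1)] by blast
  ultimately have "e - w0 \<in> ?H" by (intro span_base) blast
  then have "e - w0 + w0 \<in> ?H" using w0 span_add by blast
  then show False using e by simp
qed

text \<open>Applying \<open>P - \<sigma> b\<close> to a linear relation removes the term for
  \<open>b\<close> and multiplies the others by the nonzero numbers
  \<open>\<sigma> a - \<sigma> b\<close>.\<close>

lemma eigenvectors_independent:
  assumes "finite A" "inj_on \<sigma> A" "\<And>a. a \<in> A \<Longrightarrow> P (e a) = scale (\<sigma> a) (e a)"
    "\<And>a. a \<in> A \<Longrightarrow> e a \<noteq> 0" "(\<Sum>a\<in>A. scale (c a) (e a)) = 0" "a \<in> A"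
  shows "c a = 0"
  using assms
proof (induction A arbitrary: a c rule: finite_induct)
  case (insert b A)
  have sum: "scale (c b) (e b) + (\<Sum>a\<in>A. scale (c a) (e a)) = 0"
    using insert.prems(4) insert.hyps by simp
  have "(\<Sum>a\<in>A. scale (c a * (\<sigma> a - \<sigma> b)) (e a))
      = (\<Sum>a\<in>A. P (scale (c a) (e a)) - scale (\<sigma> b) (scale (c a) (e a)))"
    by (intro sum.cong)
      (use insert.prems(2) in \<open>auto simp: P.f_scale scale_left_diff_distrib algebra_simps\<close>)
  also have "\<dots> = P (\<Sum>a\<in>A. scale (c a) (e a)) - scale (\<sigma> b) (\<Sum>a\<in>A. scale (c a) (e a))"
    by (simp add: sum_subtractf P.f_sum scale_sum_right)
  also have "(\<Sum>a\<in>A. scale (c a) (e a)) = - scale (c b) (e b)"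
    using sum by (simp add: eq_neg_iff_add_eq_0 add.commute)
  also have "P (- scale (c b) (e b)) - scale (\<sigma> b) (- scale (c b) (e b)) = 0"
    using insert.prems(2)[of b] by (simp add: P.f_minus P.f_scale mult.commute)
  finally have "c a * (\<sigma> a - \<sigma> b) = 0" if "a \<in> A" for a
    using insert.prems that by (intro insert.IH) (auto intro: inj_on_subset)
  moreover have "\<sigma> a \<noteq> \<sigma> b" if "a \<in> A" for a
    using inj_onD[OF insert.prems(1), of a b] that insert.hyps(2) by auto
  ultimately have A: "c a = 0" if "a \<in> A" for a using that by fastforce
  then have "scale (c b) (e b) = 0" using sum by simp
  then have "c b = 0" using insert.prems(3)[of b] by simp
  then show ?case using A insert.prems(5) by blast
qed simp

lemma finitely_many_eigenvalues:
  fixes \<sigma> :: "nat \<Rightarrow> 'a"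
  assumes "G \<subseteq> span T" "finite T" "inj \<sigma>" "\<And>n. e n \<in> G"
    "\<And>n. P (e n) = scale (\<sigma> n) (e n)" "\<And>n. e n \<noteq> 0"
  shows False
proof -
  have inj: "inj e"
  proof (rule injI)
    fix m n assume "e m = e n"
    then have "scale (\<sigma> m) (e n) = scale (\<sigma> n) (e n)" using assms(5) by metis
    then show "m = n" using assms(3,6) by (simp add: inj_eq)
  qed
  have "independent (range e)"
  proof
    assume "dependent (range e)"
    then obtain S u w where S: "finite S" "S \<subseteq> range e" "(\<Sum>x\<in>S. scale (u x) x) = 0" "w \<in> S" "u w \<noteq> 0"
      unfolding dependent_explicit by blast
    obtain N where N: "S = e ` N" "finite N" using S(1,2) by (metis finite_subset_image)
    then have "(\<Sum>n\<in>N. scale (u (e n)) (e n)) = 0"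
      using S(3) by (simp add: sum.reindex inj_on_subset[OF inj])
    moreover obtain n where "n \<in> N" "w = e n" using S(4) N by blast
    ultimately have "u w = 0"
      using eigenvectors_independent[of N \<sigma> e "\<lambda>n. u (e n)" n] N(2) assms inj_on_subset by blast
    with S(5) show False by simp
  qed
  then have "finite (range e)"
    using independent_span_bound[OF assms(2)] assms(1,4) by blast
  then show False using inj finite_imageD by blast
qed

text \<open>\<open>(ad x)\<^sup>k\<close> shifts the eigenvalues of \<open>P\<close> by \<open>k \<nu> \<noteq> 0\<close>.\<close>

lemma ad_nilpotent_gen_eigenvector:
  assumes G: "subalgebra G" and PG: "\<And>x. x \<in> G \<Longrightarrow> P x \<in> G"
    and inj: "\<And>x. x \<in> G \<Longrightarrow> P x = 0 \<Longrightarrow> x = 0"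
    and k: "k \<ge> 1" and leib: "leibniz_on G k"
    and x: "x \<in> G" "gen_eigenvector \<nu> x"
  shows "ad_nilpotent G x"
proof (cases "x = 0")
  case True
  then show ?thesis by (auto simp: ad_nilpotent_def br_zero_left intro!: exI[of _ 1])
next
  case False
  have sG: "subspace G" and closed: "\<And>x y. x \<in> G \<Longrightarrow> y \<in> G \<Longrightarrow> br x y \<in> G"
    using G by (auto simp: subalgebra_def)
  obtain T where T: "finite T" "G \<subseteq> span T" using G by (auto simp: subalgebra_def)
  have shifted_in: "(shifted \<mu> ^^ n) y \<in> G" if "y \<in> G" for \<mu> n y
    using that
    by (induction n) (auto simp: shifted_def intro!: subspace_diff[OF sG] subspace_scale[OF sG] PG)
  \<comment> \<open>\<open>shifted 0\<close> is \<open>P\<close>, which is injective on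
    \<open>G\<close>, so its powers kill no nonzero vector.\<close>
  have "\<nu> \<noteq> 0"
  proof
    assume "\<nu> = 0"
    then obtain n where n: "(shifted 0 ^^ n) x = 0" using x(2) by (auto simp: gen_eigenvector_def)
    have "(shifted 0 ^^ n) y = 0 \<Longrightarrow> y \<in> G \<Longrightarrow> y = 0" for y
    proof (induction n)
      case (Suc n)
      have "P ((shifted 0 ^^ n) y) = 0"
        using Suc.prems(1) by (simp add: shifted_def[of 0 "(shifted 0 ^^ n) y"])
      then have "(shifted 0 ^^ n) y = 0" using inj[OF shifted_in] Suc.prems(2) by blast
      then show ?case using Suc by blast
    qed simp
    then show False using n x(1) False by blast
  qed
  have pow_in: "(br x ^^ n) y \<in> G" if "y \<in> G" for n y
    using that by (induction n) (auto intro: closed x)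
  \<comment> \<open>Each block of \<open>k\<close> applications of \<open>br x\<close> is one use of
    the Leibniz rule with all leading entries equal to \<open>x\<close>, and adds
    \<open>k \<nu>\<close>.\<close>
  have shift: "gen_eigenvector (of_nat m * (of_nat k * \<nu>) + \<mu>) ((br x ^^ (k * m)) y)"
    if "y \<in> G" "gen_eigenvector \<mu> y" for m \<mu> y
  proof (induction m)
    case 0
    then show ?case using that by simp
  next
    case (Suc m)
    have "(br x ^^ (k * Suc m)) y = foldr br (replicate k x) ((br x ^^ (k * m)) y)"
      by (simp add: funpow_add foldr_replicate)
    moreover have "k \<noteq> 0" using k by simp
    then have "gen_eigenvector (of_nat k * \<nu> + (of_nat m * (of_nat k * \<nu>) + \<mu>))
        (foldr br (replicate k x) ((br x ^^ (k * m)) y))"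
      using gen_eigenvector_foldr[of G "replicate k x" \<nu> "(br x ^^ (k * m)) y"
          "of_nat m * (of_nat k * \<nu>) + \<mu>", OF _ sG PG] leib x pow_in[OF that(1)] Suc
      by simp
    moreover have "of_nat k * \<nu> + (of_nat m * (of_nat k * \<nu>) + \<mu>)
        = of_nat (Suc m) * (of_nat k * \<nu>) + \<mu>"
      by (simp add: algebra_simps)
    ultimately show ?case by simp
  qed
  define Y where "Y = {v \<in> G. \<exists>n. (br x ^^ n) v = 0}"
  have pow_zero: "(br x ^^ n) 0 = 0" for n by (induction n) (auto simp: br_zero_right)
  have pow_mono: "(br x ^^ n) v = 0" if "(br x ^^ m) v = 0" "m \<le> n" for m n v
    using that pow_zero by (metis comp_apply funpow_add le_add_diff_inverse2)
  have pow_add: "(br x ^^ n) (u + v) = (br x ^^ n) u + (br x ^^ n) v" for n u v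
    by (induction n) (auto simp: br_add_right)
  have pow_scale: "(br x ^^ n) (scale c v) = scale c ((br x ^^ n) v)" for n c v
    by (induction n) (auto simp: br_scale_right)
  have "subspace Y"
  proof (rule subspaceI)
    show "0 \<in> Y" using subspace_0[OF sG] pow_zero by (auto simp: Y_def)
    fix u v assume "u \<in> Y" "v \<in> Y"
    then obtain m n where "(br x ^^ m) u = 0" "(br x ^^ n) v = 0" "u \<in> G" "v \<in> G"
      by (auto simp: Y_def)
    then have "(br x ^^ max m n) (u + v) = 0"
      using pow_mono[of m u "max m n"] pow_mono[of n v "max m n"] by (simp add: pow_add)
    then show "u + v \<in> Y" using \<open>u \<in> G\<close> \<open>v \<in> G\<close> subspace_add[OF sG] by (auto simp: Y_def)
  next
    fix c v assume "v \<in> Y"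
    then show "scale c v \<in> Y" using subspace_scale[OF sG] by (auto simp: Y_def pow_scale)
  qed
  moreover have "y \<in> Y" if y: "y \<in> G" "gen_eigenvector \<mu> y" for y \<mu>
  proof (rule ccontr)
    assume "y \<notin> Y"
    then have nz: "(br x ^^ n) y \<noteq> 0" for n using y by (auto simp: Y_def)
    let ?\<sigma> = "\<lambda>m. of_nat m * (of_nat k * \<nu>) + \<mu>"
    \<comment> \<open>The last nonzero iterate of \<open>shifted\<close> on a nonzero generalised
      eigenvector is a true eigenvector.\<close>
    have "\<exists>e. e \<in> G \<and> e \<noteq> 0 \<and> P e = scale (?\<sigma> m) e" for m
    proof -
      let ?y = "(br x ^^ (k * m)) y"
      obtain n where "(shifted (?\<sigma> m) ^^ n) ?y = 0"
        using shift[OF y, of m] by (auto simp: gen_eigenvector_def)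
      then obtain j where "(shifted (?\<sigma> m) ^^ j) ?y \<noteq> 0" "(shifted (?\<sigma> m) ^^ Suc j) ?y = 0"
        using nz by (induction n) auto
      then show ?thesis
        using shifted_in[OF pow_in[OF y(1)], of j "?\<sigma> m" "k * m"]
        by (intro exI[of _ "(shifted (?\<sigma> m) ^^ j) ?y"]) (simp add: shifted_def[of "?\<sigma> m" "_ _"])
    qed
    then obtain e where "\<And>m. e m \<in> G" "\<And>m. e m \<noteq> 0" "\<And>m. P (e m) = scale (?\<sigma> m) (e m)" by metis
    moreover have "inj ?\<sigma>" using k \<open>\<nu> \<noteq> 0\<close> by (auto intro!: injI)
    ultimately show False using finitely_many_eigenvalues[OF T(2,1), of ?\<sigma> e] by blast
  qed
  ultimately have "G \<subseteq> Y"
    using span_gen_eigenvectors[OF sG PG T(2,1)]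
      span_minimal[of "{v \<in> G. \<exists>\<nu>. gen_eigenvector \<nu> v}" Y] by blast
  then show ?thesis by (auto simp: ad_nilpotent_def Y_def)
qed

text \<open>Take a maximal \<open>P\<close>-stable subalgebra \<open>h\<close> acting nilpotently.
  If it were proper, its normaliser \<open>M\<close> would be larger because \<open>h\<close> acts
  nilpotently, and \<open>P\<close>-stable because \<open>P\<close> is a derivation. So
  \<open>M\<close> would contain a generalised eigenvector outside \<open>h\<close>, which is
  ad-nilpotent and could be adjoined.\<close>

lemma acts_nilpotently_of_derivation:
  assumes G: "subalgebra G" and PG: "\<And>x. x \<in> G \<Longrightarrow> P x \<in> G"
    and inj: "\<And>x. x \<in> G \<Longrightarrow> P x = 0 \<Longrightarrow> x = 0" and leib: "leibniz_on G 1"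
  shows "acts_nilpotently G G"
proof -
  have sG: "subspace G" and closed: "\<And>x y. x \<in> G \<Longrightarrow> y \<in> G \<Longrightarrow> br x y \<in> G"
    using G by (auto simp: subalgebra_def)
  obtain T where T: "finite T" "G \<subseteq> span T" using G by (auto simp: subalgebra_def)
  have Pbr: "P (br x y) = br x (P y) + br (P x) y" if "x \<in> G" "y \<in> G" for x y
    using leib that unfolding leibniz_on_def by (auto dest!: spec[of _ "[x]"] simp: lessThan_Suc)
  define Q where "Q h \<longleftrightarrow> subspace h \<and> h \<subseteq> G \<and> (\<forall>x\<in>h. \<forall>y\<in>h. br x y \<in> h) \<and>
    (\<forall>x\<in>h. P x \<in> h) \<and> acts_nilpotently G h" for h
  have "acts_nilpotently G {0}"
    by (rule acts_nilpotentlyI) (auto simp: br_zero_left subspace_0)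
  then have "Q {0}" using subspace_0[OF sG] by (simp add: Q_def br_zero_left P.f_zero)
  obtain h where h: "Q h" "\<And>h'. Q h' \<Longrightarrow> h \<subseteq> h' \<Longrightarrow> h' = h"
  proof (rule ex_maximal_subspace[of Q "{0}" G T])
    show "subspace h \<and> h \<subseteq> G" if "Q h" for h using that by (auto simp: Q_def)
  qed (use T \<open>Q {0}\<close> in blast)+
  have sh: "subspace h" and hG: "h \<subseteq> G" and hh: "\<And>x y. x \<in> h \<Longrightarrow> y \<in> h \<Longrightarrow> br x y \<in> h"
    and Ph: "\<And>x. x \<in> h \<Longrightarrow> P x \<in> h" and nil: "acts_nilpotently G h"
    using h(1) by (auto simp: Q_def)
  have "h = G"
  proof (rule ccontr)
    assume "h \<noteq> G"
    then have "h \<subset> G" using hG by blast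
    obtain u where u: "u \<in> G" "u \<notin> h" "\<And>x. x \<in> h \<Longrightarrow> br x u \<in> h"
      using acts_nilpotentlyD[OF nil sG sh \<open>h \<subset> G\<close> subset_refl] hh closed hG by blast
    define M where "M = {u \<in> G. \<forall>x\<in>h. br x u \<in> h}"
    have sM: "subspace M"
      using sh sG unfolding M_def
      by (auto simp: subspace_def br_add_right br_scale_right br_zero_right)
    have PM: "P v \<in> M" if "v \<in> M" for v
    proof -
      have "br x (P v) \<in> h" if x: "x \<in> h" for x
      proof -
        have "P (br x v) - br (P x) v \<in> h"
          using \<open>v \<in> M\<close> x Ph subspace_diff[OF sh] by (simp add: M_def)
        moreover have "br x (P v) = P (br x v) - br (P x) v"
          using Pbr[of x v] x \<open>v \<in> M\<close> hG by (auto simp: M_def)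
        ultimately show ?thesis by simp
      qed
      then show ?thesis using that PG by (simp add: M_def)
    qed
    have MG: "M \<subseteq> G" by (auto simp: M_def)
    have "u \<in> M" using u by (simp add: M_def)
    have "\<exists>z\<in>M. z \<notin> h \<and> (\<exists>\<nu>. gen_eigenvector \<nu> z)"
    proof (rule ccontr)
      assume "\<not> ?thesis"
      then have "{v \<in> M. \<exists>\<nu>. gen_eigenvector \<nu> v} \<subseteq> h" by blast
      then have "span {v \<in> M. \<exists>\<nu>. gen_eigenvector \<nu> v} \<subseteq> h" using sh by (rule span_minimal)
      moreover have "M \<subseteq> span {v \<in> M. \<exists>\<nu>. gen_eigenvector \<nu> v}"
        by (rule span_gen_eigenvectors[OF sM PM _ T(1)]) (use MG T in auto)
      ultimately show False using \<open>u \<in> M\<close> u(2) by blast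
    qed
    then obtain z0 \<nu> n where z0: "z0 \<in> M" "z0 \<notin> h" "(shifted \<nu> ^^ n) z0 = 0"
      by (auto simp: gen_eigenvector_def)
    then have "(shifted \<nu> ^^ n) z0 \<in> h" using subspace_0[OF sh] by simp
    \<comment> \<open>The last iterate outside \<open>h\<close> is chosen so that
      \<open>shifted \<nu> z\<close> lies in \<open>h\<close>, which keeps the span of
      \<open>h\<close> and \<open>z\<close> stable under \<open>P\<close>.\<close>
    then obtain m where m: "(shifted \<nu> ^^ m) z0 \<notin> h" "(shifted \<nu> ^^ Suc m) z0 \<in> h"
      using z0(2) by (induction n) auto
    define z where "z = (shifted \<nu> ^^ m) z0"
    have "z \<in> M"
      unfolding z_def using z0(1)
      by (induction m) (auto simp: shifted_def intro!: subspace_diff[OF sM] subspace_scale[OF sM] PM)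
    have "(shifted \<nu> ^^ n) z = (shifted \<nu> ^^ m) ((shifted \<nu> ^^ n) z0)"
      unfolding z_def by (metis add.commute comp_apply funpow_add)
    then have z_gen: "gen_eigenvector \<nu> z"
      using z0(3) by (auto simp: gen_eigenvector_def shifted_pow.f_zero)
    have z: "z \<in> G" "z \<notin> h" "\<And>x. x \<in> h \<Longrightarrow> br x z \<in> h" "shifted \<nu> z \<in> h"
      using \<open>z \<in> M\<close> m by (auto simp: M_def z_def)
    have zh: "br z x \<in> h" if "x \<in> h" for x
      using z(3)[OF that] subspace_neg[OF sh] br_swap[of z x] by simp
    let ?h = "span (insert z h)"
    have hz: "h \<subseteq> ?h" "z \<in> ?h" using span_superset[of "insert z h"] by auto
    have "Q ?h"
      unfolding Q_def
    proof (intro conjI ballI)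
      show "?h \<subseteq> G" by (rule span_minimal) (use z hG sG in auto)
      show "acts_nilpotently G ?h"
        unfolding acts_nilpotently_span
      proof (rule acts_nilpotently_insert[OF nil])
        show "br z x \<in> span h" if "x \<in> h" for x using zh[OF that] by (rule span_base)
        show "ad_nilpotent G z"
          by (rule ad_nilpotent_gen_eigenvector[OF G PG inj le_refl leib z(1) z_gen])
      qed
      show "P x \<in> ?h" if "x \<in> ?h" for x
      proof -
        have "P z = shifted \<nu> z + scale \<nu> z" by (simp add: shifted_def)
        then have "P z \<in> ?h" using z(4) hz span_add span_scale by auto
        then have "insert z h \<subseteq> {x. P x \<in> ?h}" using Ph hz by auto
        moreover have "subspace {x. P x \<in> ?h}"
          by (auto simp: subspace_def P.f_zero P.f_add P.f_scale span_zero span_add span_scale)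
        ultimately show ?thesis using that span_minimal by blast
      qed
      show "br x y \<in> ?h" if "x \<in> ?h" "y \<in> ?h" for x y
      proof (rule span_br_left[OF subspace_span _ that(1)])
        fix x assume x: "x \<in> insert z h"
        show "br x y \<in> ?h"
        proof (rule span_br_right[OF subspace_span _ that(2)])
          fix y assume "y \<in> insert z h"
          with x show "br x y \<in> ?h"
            using zh z(3) hh hz br_self[of z] span_zero by auto
        qed
      qed
    qed (rule subspace_span)
    then show False using h(2)[of ?h] hz z(2) by blast
  qed
  with nil show ?thesis by simp
qed

lemma nilpotent_of_invertible_leibniz:
  assumes "subalgebra G" "\<And>x. x \<in> G \<Longrightarrow> P x \<in> G" "\<And>x. x \<in> G \<Longrightarrow> P x = 0 \<Longrightarrow> x = 0"
    "k \<ge> 1" "leibniz_on G k"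
  shows "\<exists>n. lower_central G n = {0}"
  using assms
proof (induction "dim G" arbitrary: G rule: less_induct)
  case less
  note G = less.prems(1) and PG = less.prems(2) and inj = less.prems(3) and leib = less.prems(5)
  have sG: "subspace G" using G by (simp add: subalgebra_def)
  obtain T where T: "finite T" "G \<subseteq> span T" using G by (auto simp: subalgebra_def)
  obtain N where N: "\<And>n. n \<ge> N \<Longrightarrow> lower_central G n = lower_central G N"
    using lower_central_stable[OF G] by blast
  \<comment> \<open>The index is a multiple of \<open>k\<close>, so \<open>P\<close> maps
    \<open>?L\<close> into itself, and it is at least 1, so \<open>?L = G\<close> makes
    \<open>G\<close> perfect.\<close>
  let ?L = "lower_central G (k * Suc N)"
  have LG: "?L \<subseteq> G" by (rule lower_central_subset[OF G])
  have "acts_nilpotently G G"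
  proof (cases "?L = G")
    case True
    have "1 \<le> k * Suc N" using \<open>k \<ge> 1\<close> by (simp add: Suc_le_eq)
    then have "?L \<subseteq> lower_central G (Suc 0)" using lower_central_antimono[OF G] by simp
    then have "lower_central G (Suc 0) = G" using True lower_central_subset[OF G, of "Suc 0"] by blast
    then have "leibniz_on G 1" using derivation_of_perfect[OF G _ PG \<open>k \<ge> 1\<close> leib] by blast
    then show ?thesis using acts_nilpotently_of_derivation[OF G PG inj] by blast
  next
    case False
    have L: "subalgebra ?L" by (rule lower_central_subalgebra[OF G])
    have "\<exists>n. lower_central ?L n = {0}"
    proof (rule less.hyps)
      show "dim ?L < dim G"
        using dim_less_of_psubset[OF subspace_lower_central sG _ T(2,1)] LG False by blast
      show "P x \<in> ?L" if "x \<in> ?L" for x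
        using lower_central_mult_invariant[OF G PG leib that] .
      show "leibniz_on ?L k" using leib LG unfolding leibniz_on_def by blast
    qed (use L inj LG \<open>k \<ge> 1\<close> in auto)
    then obtain n where n: "lower_central ?L n = {0}" by blast
    have "acts_nilpotently G ?L"
    proof (rule acts_nilpotently_ideal[OF subspace_lower_central _ n])
      fix x v assume "x \<in> ?L" "v \<in> G"
      then have "br v x \<in> ?L"
        using br_in_lower_central[of v G x "k * Suc N"] lower_central_decreasing[OF G, of "k * Suc N"]
        by blast
      then show "br x v \<in> ?L"
        using br_swap[of x v] subspace_neg[OF subspace_lower_central] by simp
    qed
    then show ?thesis
    proof (rule acts_nilpotently_of_spanning[OF G])
      show "G \<subseteq> span {v \<in> G. \<exists>\<nu>. gen_eigenvector \<nu> v}"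
        by (rule span_gen_eigenvectors[OF sG PG T(2,1)])
    qed (use ad_nilpotent_gen_eigenvector[OF G PG inj \<open>k \<ge> 1\<close> leib] in blast)+
  qed
  then show ?case by (rule nilpotent_of_acts_nilpotently[OF G])
qed

end

section \<open>Extension of scalars\<close>

definition ext_scale :: "'k::field \<Rightarrow> ('v \<Rightarrow> 'k) \<Rightarrow> 'v \<Rightarrow> 'k" where
  "ext_scale c f = (\<lambda>x. c * f x)"

lemma vector_space_ext_scale: "vector_space ext_scale"
  by unfold_locales (auto simp: ext_scale_def fun_eq_iff algebra_simps)

text \<open>The algebra over the algebraic closure is the span of \<open>\<iota> ` B\<close>,
  i.e. the functions supported on the basis \<open>B\<close>; the bracket is defined on all functions, those
  vanishing on \<open>B\<close> being central.\<close>

locale fd_lie_endo = lie_endo scale br P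
  for scale :: "'a::field_char_0 \<Rightarrow> 'b::ab_group_add \<Rightarrow> 'b" and br P +
  fixes B :: "'b set"
  assumes finite_B: "finite B" and independent_B: "independent B" and span_B: "span B = UNIV"
begin

interpretation K: vector_space "ext_scale :: 'a alg_closure \<Rightarrow> ('b \<Rightarrow> 'a alg_closure) \<Rightarrow> _"
  by (rule vector_space_ext_scale)

definition \<iota> :: "'b \<Rightarrow> 'b \<Rightarrow> 'a alg_closure" where
  "\<iota> v = (\<lambda>b. to_ac (representation B v b))"

definition ext_lin :: "('b \<Rightarrow> 'b) \<Rightarrow> ('b \<Rightarrow> 'a alg_closure) \<Rightarrow> 'b \<Rightarrow> 'a alg_closure" where
  "ext_lin Q f = (\<Sum>b\<in>B. ext_scale (f b) (\<iota> (Q b)))"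

definition ext_br :: "('b \<Rightarrow> 'a alg_closure) \<Rightarrow> ('b \<Rightarrow> 'a alg_closure) \<Rightarrow> 'b \<Rightarrow> 'a alg_closure" where
  "ext_br f g = (\<Sum>b\<in>B. ext_scale (f b) (ext_lin (br b) g))"

lemma \<iota>_add: "\<iota> (x + y) = \<iota> x + \<iota> y"
  using representation_add[OF independent_B, of y x] span_B by (simp add: \<iota>_def fun_eq_iff)

lemma \<iota>_scale: "\<iota> (scale c x) = ext_scale (to_ac c) (\<iota> x)"
  using representation_scale[OF independent_B, of x c] span_B
  by (simp add: \<iota>_def fun_eq_iff ext_scale_def)

lemma \<iota>_zero: "\<iota> 0 = 0"
  using \<iota>_scale[of 0 0] by simp

lemma \<iota>_sum: "\<iota> (sum f A) = (\<Sum>a\<in>A. \<iota> (f a))"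
  by (induction A rule: infinite_finite_induct) (auto simp: \<iota>_zero \<iota>_add)

lemma sum_representation: "(\<Sum>b\<in>B. scale (representation B v b) b) = v"
  using sum_representation_eq[OF independent_B _ finite_B, of v] span_B by simp

lemma \<iota>_eq_0: "\<iota> v = 0 \<Longrightarrow> v = 0"
  using sum_representation[of v] by (simp add: \<iota>_def fun_eq_iff)

lemma ext_lin_add: "ext_lin Q (f + g) = ext_lin Q f + ext_lin Q g"
  by (simp add: ext_lin_def K.scale_left_distrib sum.distrib)

lemma ext_lin_scale: "ext_lin Q (ext_scale c f) = ext_scale c (ext_lin Q f)"
  by (simp add: ext_lin_def K.scale_sum_right) (simp add: ext_scale_def mult.assoc)

lemma ext_lin_sum: "ext_lin Q (sum f A) = (\<Sum>a\<in>A. ext_lin Q (f a))"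
  using ext_lin_scale[of Q 0 0]
  by (induction A rule: infinite_finite_induct) (auto simp: ext_lin_add)

lemma ext_lin_\<iota>:
  assumes "vs_endo scale Q" shows "ext_lin Q (\<iota> v) = \<iota> (Q v)"
proof -
  interpret Q: vs_endo scale Q by fact
  have "ext_lin Q (\<iota> v) = \<iota> (\<Sum>b\<in>B. scale (representation B v b) (Q b))"
    by (simp add: ext_lin_def \<iota>_sum \<iota>_scale) (simp add: \<iota>_def)
  also have "(\<Sum>b\<in>B. scale (representation B v b) (Q b)) = Q v"
    by (subst (2) sum_representation[of v, symmetric]) (simp add: Q.f_sum Q.f_scale)
  finally show ?thesis .
qed

lemma ext_br_\<iota>_left: "ext_br f (\<iota> y) = ext_lin (\<lambda>x. br x y) f"
  by (simp add: ext_br_def ext_lin_def[of "\<lambda>x. br x y"] ext_lin_\<iota>[OF ad.vs_endo_axioms])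

lemma ext_br_\<iota>: "ext_br (\<iota> x) (\<iota> y) = \<iota> (br x y)"
  by (simp add: ext_br_\<iota>_left ext_lin_\<iota>[OF ad_right.vs_endo_axioms])

lemma ext_br_add_left: "ext_br (f + g) h = ext_br f h + ext_br g h"
  by (simp add: ext_br_def K.scale_left_distrib sum.distrib)

lemma ext_br_add_right: "ext_br f (g + h) = ext_br f g + ext_br f h"
  by (simp add: ext_br_def ext_lin_add K.scale_right_distrib sum.distrib)

lemma ext_br_scale_left: "ext_br (ext_scale c f) h = ext_scale c (ext_br f h)"
  by (simp add: ext_br_def K.scale_sum_right) (simp add: ext_scale_def mult.assoc)

lemma ext_br_scale_right: "ext_br f (ext_scale c h) = ext_scale c (ext_br f h)"
  by (simp add: ext_br_def ext_lin_scale K.scale_sum_right mult.commute)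

text \<open>The projection onto functions supported on \<open>B\<close>:
  \<open>F (restrict_B f) = F f\<close> expresses that \<open>F\<close> sees only the values on
  \<open>B\<close>.\<close>

definition restrict_B :: "('b \<Rightarrow> 'a alg_closure) \<Rightarrow> 'b \<Rightarrow> 'a alg_closure" where
  "restrict_B f = (\<Sum>b\<in>B. ext_scale (f b) (\<iota> b))"

lemma restrict_B_apply: "b \<in> B \<Longrightarrow> restrict_B f b = f b"
proof -
  assume b: "b \<in> B"
  have sum_apply: "sum g A x = (\<Sum>a\<in>A. g a x)" for g :: "'b \<Rightarrow> 'b \<Rightarrow> 'a alg_closure" and A x
    by (induction A rule: infinite_finite_induct) auto
  have "restrict_B f b = (\<Sum>c\<in>B. if b = c then f c else 0)"
    unfolding restrict_B_def sum_apply
    by (intro sum.cong)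
      (auto simp: ext_scale_def \<iota>_def representation_basis[OF independent_B])
  also have "\<dots> = f b" using b finite_B by simp
  finally show ?thesis .
qed

lemma ext_lin_restrict_B: "ext_lin Q (restrict_B f) = ext_lin Q f"
  by (simp add: ext_lin_def restrict_B_apply)

lemma ext_br_restrict_B: "ext_br (restrict_B f) g = ext_br f g" "ext_br f (restrict_B g) = ext_br f g"
  by (simp_all add: ext_br_def ext_lin_restrict_B restrict_B_apply)

text \<open>\<open>restrict_B f\<close> is a combination of vectors \<open>\<iota> b\<close>, so
  such an \<open>F\<close> is determined by the image of \<open>\<iota>\<close>. Multilinear
  identities are transferred with this, one argument at a time.\<close>

lemma eq_0_by_extension:
  fixes F :: "('b \<Rightarrow> 'a alg_closure) \<Rightarrow> 'b \<Rightarrow> 'a alg_closure"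
  assumes add: "\<And>f g. F (f + g) = F f + F g" and scale: "\<And>c f. F (ext_scale c f) = ext_scale c (F f)"
    and restrict: "\<And>f. F (restrict_B f) = F f" and zero: "\<And>v. F (\<iota> v) = 0"
  shows "F f = 0"
proof -
  have "F 0 = 0" using zero[of 0] by (simp add: \<iota>_zero)
  then have "F (sum g A) = (\<Sum>a\<in>A. F (g a))" for g and A :: "'b set"
    by (induction A rule: infinite_finite_induct) (auto simp: add)
  then have "F (restrict_B f) = 0" by (simp add: restrict_B_def scale zero)
  then show ?thesis by (simp add: restrict)
qed

lemma ext_br_swap: "ext_br f g + ext_br g f = 0"
proof -
  have *: "ext_br f (\<iota> y) + ext_br (\<iota> y) f = 0" for f y
    by (rule eq_0_by_extension[of "\<lambda>f. ext_br f (\<iota> y) + ext_br (\<iota> y) f"])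
      (simp_all add: ext_br_add_left ext_br_add_right ext_br_scale_left ext_br_scale_right
        K.scale_right_distrib ext_br_restrict_B ext_br_\<iota> br_swap[of _ y] flip: \<iota>_add \<iota>_zero)
  show ?thesis
    by (rule eq_0_by_extension[of "\<lambda>g. ext_br f g + ext_br g f"])
      (simp_all add: ext_br_add_left ext_br_add_right ext_br_scale_left ext_br_scale_right
        K.scale_right_distrib ext_br_restrict_B *)
qed

text \<open>In \<open>1\<close>, \<open>2\<close> and the final claim, two, one and none of the
  arguments are confined to the image of \<open>\<iota>\<close>.\<close>

lemma ext_br_jacobi: "ext_br f (ext_br g h) + ext_br g (ext_br h f) + ext_br h (ext_br f g) = 0"
proof -
  note simps = ext_br_add_left ext_br_add_right ext_br_scale_left ext_br_scale_right
    K.scale_right_distrib ext_br_restrict_B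
  have 1: "ext_br f (ext_br (\<iota> x) (\<iota> y)) + ext_br (\<iota> x) (ext_br (\<iota> y) f)
      + ext_br (\<iota> y) (ext_br f (\<iota> x)) = 0" for f x y
    by (rule eq_0_by_extension[of "\<lambda>f. ext_br f (ext_br (\<iota> x) (\<iota> y)) + ext_br (\<iota> x) (ext_br (\<iota> y) f)
        + ext_br (\<iota> y) (ext_br f (\<iota> x))"])
      (simp_all add: simps ext_br_\<iota> br_jacobi flip: \<iota>_add \<iota>_zero)
  have 2: "ext_br f (ext_br g (\<iota> y)) + ext_br g (ext_br (\<iota> y) f) + ext_br (\<iota> y) (ext_br f g) = 0" for f g y
    by (rule eq_0_by_extension[of "\<lambda>g. ext_br f (ext_br g (\<iota> y)) + ext_br g (ext_br (\<iota> y) f)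
        + ext_br (\<iota> y) (ext_br f g)"])
      (simp_all add: simps 1)
  show ?thesis
    by (rule eq_0_by_extension[of "\<lambda>h. ext_br f (ext_br g h) + ext_br g (ext_br h f) + ext_br h (ext_br f g)"])
      (simp_all add: simps 2)
qed

sublocale ext: ac_lie_endo "ext_scale :: 'a alg_closure \<Rightarrow> ('b \<Rightarrow> 'a alg_closure) \<Rightarrow> _" ext_br "ext_lin P"
proof
  \<comment> \<open>Antisymmetry gives \<open>2 [f, f] = 0\<close>, and 2 is invertible.\<close>
  show "ext_br f f = 0" for f
  proof -
    have "ext_scale (1 + 1) (ext_br f f) = 0"
      using ext_br_swap[of f f] by (simp only: K.scale_left_distrib K.scale_one)
    then show ?thesis by simp
  qed
qed (rule ext_br_add_left ext_br_add_right ext_br_scale_left ext_br_scale_right ext_br_jacobi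
    ext_lin_add ext_lin_scale)+

interpretation ext_dual: lie "\<lambda>a x. (ext_scale a (fst x), ext_scale a (snd x))" ext.dual_br
  by (rule ext.lie_dual)

definition ext_carrier :: "('b \<Rightarrow> 'a alg_closure) set" where
  "ext_carrier = K.span (\<iota> ` B)"

lemma \<iota>_in_ext_carrier: "\<iota> v \<in> ext_carrier"
proof -
  have "\<iota> v = (\<Sum>b\<in>B. ext_scale (to_ac (representation B v b)) (\<iota> b))"
    by (subst (1) sum_representation[of v, symmetric]) (simp add: \<iota>_sum \<iota>_scale)
  also have "\<dots> \<in> ext_carrier"
    unfolding ext_carrier_def by (intro K.span_sum K.span_scale K.span_base) auto
  finally show ?thesis .
qed

lemma ext_lin_in_ext_carrier: "ext_lin Q f \<in> ext_carrier"
  unfolding ext_lin_def ext_carrier_def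
  using \<iota>_in_ext_carrier by (intro K.span_sum K.span_scale) (simp add: ext_carrier_def)

lemma subalgebra_ext_carrier: "ext.subalgebra ext_carrier"
proof -
  have "ext_br f g \<in> ext_carrier" for f g
    unfolding ext_br_def ext_carrier_def
    using ext_lin_in_ext_carrier by (intro K.span_sum K.span_scale) (simp add: ext_carrier_def)
  then show ?thesis
    using finite_B unfolding ext.subalgebra_def ext_carrier_def by blast
qed

lemma restrict_B_ext_carrier:
  assumes "f \<in> ext_carrier" shows "restrict_B f = f"
proof -
  have "restrict_B = ext_lin (\<lambda>x. x)" by (simp add: restrict_B_def ext_lin_def fun_eq_iff)
  then have "K.subspace {f. restrict_B f = f}"
    using ext_lin_add[of "\<lambda>x. x"] ext_lin_scale[of "\<lambda>x. x"] ext_lin_scale[of "\<lambda>x. x" 0 0]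
    by (simp add: K.subspace_def)
  moreover have "vs_endo scale (\<lambda>x. x)" by unfold_locales (rule refl)+
  then have "\<iota> ` B \<subseteq> {f. restrict_B f = f}"
    using \<open>restrict_B = _\<close> ext_lin_\<iota>[of "\<lambda>x. x"] by auto
  ultimately show ?thesis using assms K.span_minimal unfolding ext_carrier_def by blast
qed

text \<open>The linear extension of the inverse of \<open>P\<close> is a left inverse on
  \<open>ext_carrier\<close>.\<close>

lemma ext_lin_injective:
  assumes "bij P" "f \<in> ext_carrier" "ext_lin P f = 0"
  shows "f = 0"
proof -
  have inv: "inv_into UNIV P (P x) = x" "P (inv_into UNIV P x) = x" for x
    using assms(1) by (auto simp: bij_is_inj bij_is_surj surj_f_inv_f)
  have Q: "vs_endo scale (inv_into UNIV P)"
  proof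
    show "inv_into UNIV P (x + y) = inv_into UNIV P x + inv_into UNIV P y" for x y
      by (metis inv P.f_add)
    show "inv_into UNIV P (scale a x) = scale a (inv_into UNIV P x)" for a x
      by (metis inv P.f_scale)
  qed
  have "ext_lin (inv_into UNIV P) (ext_lin P f) = restrict_B f"
    by (simp add: ext_lin_def[of P] ext_lin_sum ext_lin_scale ext_lin_\<iota>[OF Q] inv restrict_B_def)
  then show ?thesis
    using assms(2,3) ext_lin_scale[of "inv_into UNIV P" 0 0] by (simp add: restrict_B_ext_carrier)
qed

section \<open>Transfer of the Leibniz rule and descent of nilpotency\<close>

lemma foldr_ext_br_\<iota>: "foldr ext_br (map \<iota> us) (\<iota> v) = \<iota> (foldr br us v)"
  by (induction us) (auto simp: ext_br_\<iota>)

lemma leibniz_on_ext: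
  assumes "leibniz_on UNIV k" and k: "k \<ge> 1"
  shows "ext.leibniz_on UNIV k"
proof -
  \<comment> \<open>The failure of the Leibniz rule, with the right-hand side as a dual-number word,
    which makes linearity in each slot visible.\<close>
  define E where "E us v = ext_lin P (foldr ext_br us v)
      - snd (foldr ext.dual_br (map ext.\<theta> us) (ext.\<theta> v))" for us v
  have \<theta>_add: "ext.\<theta> (f + g) = ext.\<theta> f + ext.\<theta> g"
    and \<theta>_scale: "ext.\<theta> (ext_scale c f) = (ext_scale c (fst (ext.\<theta> f)), ext_scale c (snd (ext.\<theta> f)))"
    for c f g
    by (simp_all add: ext.\<theta>_def ext_lin_add ext_lin_scale)
  have \<theta>_\<iota>: "ext.\<theta> (\<iota> v) = (\<iota> (fst (\<theta> v)), \<iota> (snd (\<theta> v)))" for v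
    by (simp add: ext.\<theta>_def \<theta>_def ext_lin_\<iota>[OF P.vs_endo_axioms])
  have dual_\<iota>: "ext.dual_br (\<iota> (fst a), \<iota> (snd a)) (\<iota> (fst b), \<iota> (snd b))
      = (\<iota> (fst (dual_br a b)), \<iota> (snd (dual_br a b)))" for a b
    by (simp add: ext.dual_br_def dual_br_def ext_br_\<iota> \<iota>_add)
  have base: "E (map \<iota> us) (\<iota> v) = 0" if "length us = k" for us v
  proof -
    have "foldr ext.dual_br (map ext.\<theta> (map \<iota> us)) (ext.\<theta> (\<iota> v))
        = (\<iota> (fst (foldr dual_br (map \<theta> us) (\<theta> v))), \<iota> (snd (foldr dual_br (map \<theta> us) (\<theta> v))))"
      by (induction us) (simp_all add: \<theta>_\<iota> dual_\<iota> del: map_map)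
    moreover have "foldr dual_br (map \<theta> us) (\<theta> v) = \<theta> (foldr br us v)"
      using leibniz_on_dual[of UNIV us v] assms that by simp
    ultimately show ?thesis
      by (simp add: E_def foldr_ext_br_\<iota> ext_lin_\<iota>[OF P.vs_endo_axioms]) (simp add: \<theta>_def)
  qed
  have slot: "E (us @ f # vs) v = 0" if "\<And>w. E (us @ \<iota> w # vs) v = 0" for us vs v f
  proof -
    define y where "y = foldr ext_br vs v"
    define z where "z = foldr ext.dual_br (map ext.\<theta> vs) (ext.\<theta> v)"
    define F where "F f = ext_lin P (foldr ext_br us (ext_br f y))
      - snd (foldr ext.dual_br (map ext.\<theta> us) (ext.dual_br (ext.\<theta> f) z))" for f
    have F: "E (us @ f # vs) v = F f" for f
      by (simp add: E_def F_def y_def z_def)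
    have "F f = 0"
    proof (rule eq_0_by_extension[of F])
      show "F (f + g) = F f + F g" for f g
        by (simp add: F_def ext_br_add_left ext.foldr_br_add ext_lin_add \<theta>_add
            ext_dual.br_add_left ext_dual.foldr_br_add)
      show "F (ext_scale c f) = ext_scale c (F f)" for c f
        by (simp add: F_def ext_br_scale_left ext.foldr_br_scale ext_lin_scale \<theta>_scale
            ext_dual.br_scale_left ext_dual.foldr_br_scale K.scale_right_diff_distrib)
      have "ext.dual_br (ext.\<theta> (restrict_B f)) z = ext.dual_br (ext.\<theta> f) z" for f
        by (simp add: ext.dual_br_def ext.\<theta>_def ext_br_restrict_B ext_lin_restrict_B)
      then show "F (restrict_B f) = F f" for f
        by (simp add: F_def ext_br_restrict_B)
      show "F (\<iota> w) = 0" for w using that[of w] by (simp add: F)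
    qed
    then show ?thesis by (simp add: F)
  qed
  \<comment> \<open>Entries are freed from left to right: those in \<open>us\<close> are arbitrary,
    the others still lie in the image of \<open>\<iota>\<close>.\<close>
  have prefix: "E (us @ map \<iota> vs) (\<iota> v) = 0" if "length us + length vs = k" for us vs v
    using that
  proof (induction us arbitrary: vs rule: rev_induct)
    case Nil
    then show ?case using base by simp
  next
    case (snoc f us)
    have "E (us @ f # map \<iota> vs) (\<iota> v) = 0"
    proof (rule slot)
      show "E (us @ \<iota> w # map \<iota> vs) (\<iota> v) = 0" for w
        using snoc.IH[of "w # vs"] snoc.prems by (simp add: zero_fun_def)
    qed
    then show ?case by simp
  qed
  have "E us v = 0" if len: "length us = k" for us v
  proof (rule eq_0_by_extension[of "E us"])
    show "E us (f + g) = E us f + E us g" for f g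
      by (simp add: E_def ext.foldr_br_add ext_lin_add \<theta>_add ext_dual.foldr_br_add)
    show "E us (ext_scale c f) = ext_scale c (E us f)" for c f
      by (simp add: E_def ext.foldr_br_scale ext_lin_scale \<theta>_scale ext_dual.foldr_br_scale
          K.scale_right_diff_distrib)
    \<comment> \<open>As \<open>k \<ge> 1\<close>, the last entry sits inside a bracket, so only its
      values on \<open>B\<close> matter.\<close>
    obtain us' x where us: "us = us' @ [x]" using len k by (cases us rule: rev_cases) auto
    have "ext.dual_br (ext.\<theta> x) (ext.\<theta> (restrict_B f)) = ext.dual_br (ext.\<theta> x) (ext.\<theta> f)" for f
      by (simp add: ext.dual_br_def ext.\<theta>_def ext_br_restrict_B ext_lin_restrict_B)
    then show "E us (restrict_B f) = E us f" for f
      by (simp add: E_def us ext_br_restrict_B)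
    show "E us (\<iota> w) = 0" for w using prefix[of us "[]" w] that by simp
  qed
  then show ?thesis
    by (simp add: ext.leibniz_on_def E_def ext.foldr_dual_theta)
qed

text \<open>\<open>\<iota>\<close> sends words to words over \<open>ext_carrier\<close>, which
  vanish from some length on, and \<open>\<iota>\<close> is injective.\<close>

lemma nilpotent_of_bij_leibniz:
  assumes "bij P" "k \<ge> 1" "leibniz_on UNIV k"
  shows "\<exists>n. lower_central UNIV n = {0}"
proof -
  have "ext.leibniz_on ext_carrier k"
    using leibniz_on_ext[OF assms(3,2)] by (simp add: ext.leibniz_on_def)
  then obtain n where n: "ext.lower_central ext_carrier n = {0}"
    using ext.nilpotent_of_invertible_leibniz[OF subalgebra_ext_carrier ext_lin_in_ext_carrier
        ext_lin_injective[OF assms(1)] assms(2)] by blast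
  have "foldr br us v = 0" if "length us = n" for us v
  proof -
    have "foldr ext_br (map \<iota> us) (\<iota> v) \<in> ext.lower_central ext_carrier n"
      unfolding ext.lower_central_def
      using that \<iota>_in_ext_carrier
      by (intro K.span_base CollectI exI[of _ "map \<iota> us"] exI[of _ "\<iota> v"]) auto
    then have "\<iota> (foldr br us v) = 0" by (simp only: n foldr_ext_br_\<iota> singleton_iff)
    then show ?thesis by (rule \<iota>_eq_0)
  qed
  then have "{foldr br us v |us v. length us = n \<and> set us \<subseteq> UNIV \<and> v \<in> UNIV} \<subseteq> {0}" by auto
  then have "lower_central UNIV n \<subseteq> {0}"
    unfolding lower_central_def by (intro span_minimal) auto
  then show ?thesis using subspace_0[OF subspace_lower_central, of UNIV n] by blast
qed

end

section \<open>From the locales to the stated equivalence\<close>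

lemma lie_of_lie_algebra:
  assumes "lie_algebra scale br" shows "lie scale br"
proof -
  interpret vector_space scale using assms by (simp add: lie_algebra_def)
  show ?thesis
    using assms by unfold_locales (auto simp: lie_algebra_def Vector_Spaces.linear_iff)
qed

lemma (in lie) lcs_eq_lower_central: "lcs scale br n = lower_central UNIV n"
  by (induction n) (simp_all add: lower_central_0 lower_central_Suc)

lemma nested_append: "nested br (us @ [v]) = foldr br us v"
proof (induction us)
  case (Cons u us)
  then show ?case by (cases "us @ [v]") auto
qed simp

theorem mainTheorem1:
  fixes scale :: "'a::field_char_0 \<Rightarrow> 'v::ab_group_add \<Rightarrow> 'v"
    and br :: "'v \<Rightarrow> 'v \<Rightarrow> 'v"
  assumes "lie_algebra scale br"
    and "fin_dim scale"
  shows "lie_nilpotent scale br \<longleftrightarrow>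
    (\<exists>k P. k \<ge> 1 \<and> bij P \<and> leibniz_derivation scale br k P)"
proof -
  interpret lie scale br using assms(1) by (rule lie_of_lie_algebra)
  show ?thesis
  proof
    assume "lie_nilpotent scale br"
    then obtain n where "lower_central UNIV n = {0}"
      by (auto simp: lie_nilpotent_def lcs_eq_lower_central)
    \<comment> \<open>Passing from \<open>n\<close> to \<open>Suc n\<close> keeps the term zero and
      makes the order at least 1.\<close>
    then have zero: "lower_central UNIV (Suc n) = {0}"
      by (simp add: lower_central_Suc br_zero_right)
    have nested_0: "nested br xs = 0" if len: "length xs = Suc n + 1" for xs
    proof -
      obtain us v where xs: "xs = us @ [v]" using len by (cases xs rule: rev_cases) auto
      have "foldr br us v \<in> lower_central UNIV (Suc n)"
        unfolding lower_central_def using len xs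
        by (intro span_base CollectI exI[of _ us] exI[of _ v]) simp
      then show ?thesis using zero xs by (simp add: nested_append)
    qed
    \<comment> \<open>For \<open>id\<close> both sides of the Leibniz rule consist of vanishing
      words with \<open>Suc n + 1\<close> entries.\<close>
    have "leibniz_derivation scale br (Suc n) id"
      unfolding leibniz_derivation_def Vector_Spaces.linear_iff
      using vector_space_axioms nested_0 by simp
    moreover have "bij (id :: 'v \<Rightarrow> 'v)" by simp
    moreover have "Suc n \<ge> 1" by simp
    ultimately show "\<exists>k P. k \<ge> 1 \<and> bij P \<and> leibniz_derivation scale br k P" by blast
  next
    assume "\<exists>k P. k \<ge> 1 \<and> bij P \<and> leibniz_derivation scale br k P"
    then obtain k P where k: "k \<ge> 1" and "bij P" and P: "leibniz_derivation scale br k P" by blast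
    obtain B0 where B0: "finite B0" "span B0 = UNIV" using assms(2) by (auto simp: fin_dim_def)
    obtain B where B: "B \<subseteq> B0" "independent B" "B0 \<subseteq> span B"
      using maximal_independent_subset by blast
    have "span B = UNIV" using span_minimal[OF B(3) subspace_span] B0(2) by blast
    moreover have "finite B" using B(1) B0(1) by (rule finite_subset)
    ultimately interpret fd_lie_endo scale br P B
      using P B(2) by unfold_locales (simp_all add: leibniz_derivation_def Vector_Spaces.linear_iff)
    have "leibniz_on UNIV k"
      unfolding leibniz_on_def
    proof (intro allI impI)
      fix us :: "'v list" and v assume us: "length us = k"
      have "P (nested br (us @ [v])) = (\<Sum>i<k + 1. nested br ((us @ [v])[i := P ((us @ [v]) ! i)]))"
        using P us by (simp add: leibniz_derivation_def)
      \<comment> \<open>The summand with index \<open>k\<close>, where \<open>P\<close> hits the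
        last entry \<open>v\<close>, is split off.\<close>
      also have "\<dots> = (\<Sum>i<k. nested br (us[i := P (us ! i)] @ [v])) + nested br (us @ [P v])"
        using us by (simp add: list_update_append nth_append)
      finally show "P (foldr br us v) = foldr br us (P v) + (\<Sum>i<k. foldr br (us[i := P (us ! i)]) v)"
        by (simp add: nested_append)
    qed
    then show "lie_nilpotent scale br"
      using nilpotent_of_bij_leibniz[OF \<open>bij P\<close> k] by (simp add: lie_nilpotent_def lcs_eq_lower_central)
  qed
qed

end
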